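(* Consider the $L$-layer LSTM described in the context and let $k\in\mathbb{Z}_{\ge0}$. Assume $\rho(A^{(l)}_s(k))<1$ for all $l\in[L]$. Let $x(t),\widehat{x}(t)\in[-x_{\max},x_{\max}]^{n_x}$, $t\ge0$, be infinite input sequences, let $e>0$, and assume there exists $t_0$ with $x(t)=\widehat{x}(t)$ for all $t\ge t_0$. Then $\sup_{s(0)\in\prod_{l=1}^L\mathcal{S}^{(l)}(k)}T_R(x,\widehat{x},s(0);e)\le\min\{t\ge0:\tilde\beta(2\sqrt{n_c}\,\bar s(k),t';k)\le e/\|U_y\|\text{ for all }t'\ge t\}$, where $\bar s(k)=(\bar s^{(1)}(k),\dots,\bar s^{(L)}(k))$, $\bar s^{(l)}(k)=\|(\overline{c}^{(l)}(k),\phi(\overline{c}^{(l)}(k))\overline{\sigma}^{(l)}_o(k))\|$, and $2\sqrt{n_c}\,\bar s(k)$ is the $L$-tuple $(2\sqrt{n_c}\bar s^{(1)}(k),\dots,2\sqrt{n_c}\bar s^{(L)}(k))$.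
   Context: LSTM: fix $L\in\mathbb{N}$, dimensions $n_x,n_c,n_y$, $x_{\max}>0$. For $l\in[L]$ let $n^{(l)}=n_x$ if $l=1$, $n^{(l)}=n_c$ if $l\ge2$; weights $W^{(l)}_*\in\mathbb{R}^{n_c\times n^{(l)}}$, $U^{(l)}_*\in\mathbb{R}^{n_c\times n_c}$, biases $b^{(l)}_*\in\mathbb{R}^{n_c}$, $*\in\{f,i,c,o\}$, and $U_y\in\mathbb{R}^{n_y\times n_c}$, $b_y\in\mathbb{R}^{n_y}$. With $\sigma(w)=1/(1+e^{-w})$, $\phi=\tanh$, $\odot$ componentwise product: $c^{(l)}(t+1)=\sigma(W^{(l)}_f x^{(l)}(t)+U^{(l)}_f h^{(l)}(t)+b^{(l)}_f)\odot c^{(l)}(t)+\sigma(W^{(l)}_i x^{(l)}(t)+U^{(l)}_i h^{(l)}(t)+b^{(l)}_i)\odot\phi(W^{(l)}_c x^{(l)}(t)+U^{(l)}_c h^{(l)}(t)+b^{(l)}_c)$, $h^{(l)}(t+1)=\sigma(W^{(l)}_o x^{(l)}(t)+U^{(l)}_o h^{(l)}(t)+b^{(l)}_o)\odot\phi(c^{(l)}(t+1))$, $y(t)=U_y h^{(L)}(t)+b_y$, with $x^{(1)}(t)=x(t)$, $x^{(l)}(t)=h^{(l-1)}(t+1)$ for $l\ge2$; $s^{(l)}=(c^{(l)},h^{(l)})$, $s=(s^{(1)},\dots,s^{(L)})$. $y(t,s(0),x(0:t))$ denotes the output at time $t$ from initial state $s(0)$ under input $x$. Recovery time: for inputs as in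 the claim, $T_R(x,\widehat{x},s(0);e)=\min\{t\ge t_0:\|y(t',s(0),x(0:t'))-y(t',s(0),\widehat{x}(0:t'))\|\le e\text{ for all }t'\ge t\}-t_0$, and $T_R=\infty$ if this set is empty. Quantities: $x^{(l)}_{\max}=x_{\max}$ if $l=1$, $=1$ if $l\ge2$; $|A|$ entrywise absolute value; $\mathbf{1}_n$ all-ones vector; $v_+$ componentwise positive part; $\|\cdot\|_\infty$ max norm. For $\eta\ge0$, $*\in\{f,i,o\}$: $G^{(l)}_*(\eta)=\|(x^{(l)}_{\max}|W^{(l)}_*|\mathbf{1}_{n^{(l)}}+\eta|U^{(l)}_*|\mathbf{1}_{n_c}+b^{(l)}_* )_+\|_\infty$, $G^{(l)}_c(\eta)=\|x^{(l)}_{\max}|W^{(l)}_c|\mathbf{1}_{n^{(l)}}+\eta|U^{(l)}_c|\mathbf{1}_{n_c}+|b^{(l)}_c|\|_\infty$. With $\eta^{(l)}(-1)=1$, $k\ge0$: $\overline{\sigma}^{(l)}_*(k)=\sigma(G^{(l)}_*(\eta^{(l)}(k-1)))$, $\overline{\phi}^{(l)}_c(k)=\phi(G^{(l)}_c(\eta^{(l)}(k-1)))$, $\overline{c}^{(l)}(k)=\overline{\sigma}^{(l)}_i(k)\overline{\phi}^{(l)}_c(k)/(1-\overline{\sigma}^{(l)}_f(k))$, $\eta^{(l)}(k)=\phi(\overline{c}^{(l)}(k))\overline{\sigma}^{(l)}_o(k)$. $\mathcal{S}^{(l)}(k)=\{(c,h):\|c\|_\infty\le\overline{c}^{(l)}(k),\|h\|_\infty\le\phi(\overline{c}^{(l)}(k))\overline{\sigma}^{(l)}_o(k)\}$.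 With $\|\cdot\|$ Euclidean norm / induced 2-norm: $\alpha^{(l)}_s(k)=\tfrac14\|U^{(l)}_f\|\overline{c}^{(l)}(k)+\overline{\sigma}^{(l)}_i(k)\|U^{(l)}_c\|+\tfrac14\|U^{(l)}_i\|\overline{\phi}^{(l)}_c(k)$, $A^{(l)}_s(k)=\begin{bmatrix}\overline{\sigma}^{(l)}_f(k)&\alpha^{(l)}_s(k)\\ \overline{\sigma}^{(l)}_o(k)\overline{\sigma}^{(l)}_f(k)&\alpha^{(l)}_s(k)\overline{\sigma}^{(l)}_o(k)+\tfrac14\phi(\overline{c}^{(l)}(k))\|U^{(l)}_o\|\end{bmatrix}$, $\rho$ spectral radius; $\alpha^{(l)}_x(k)=\tfrac14\|W^{(l)}_f\|\overline{c}^{(l)}(k)+\overline{\sigma}^{(l)}_i(k)\|W^{(l)}_c\|+\tfrac14\|W^{(l)}_i\|\overline{\phi}^{(l)}_c(k)$, $a^{(l)}_x(k)=(\alpha^{(l)}_x(k),\ \alpha^{(l)}_x(k)\overline{\sigma}^{(l)}_o(k)+\tfrac14\phi(\overline{c}^{(l)}(k))\|W^{(l)}_o\|)^\top$. For nonnegative scalars $s^{(1)},\dots,s^{(L)}$: $\tilde\beta(s^{(1:L)},t;k)=\mu^{(L)}(t)\rho(A^{(L)}_s(k))^t s^{(L)}+\sum_{l=1}^{L-1}\mu^{(l:L)}(t)\frac{(t+L-l)!}{t!(L-l)!}\max_{i=l,\dots,L}\rho(A^{(i)}_s(k))^t\big(\prod_{i=l+1}^L\|a^{(i)}_x(k)\|\big)s^{(l)}$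 (sum $=0$ if $L=1$), where $\mu^{(l:L)}(t)=\prod_{i=l}^L\mu^{(i)}(t)$, $\mu^{(l)}(t)=\sqrt{(1+(r^{(l)})^{2t})+\frac{|\nu^{(l)}|^2}{|\lambda^{(l)}_1|^2}\big(\frac{1-(r^{(l)})^t}{1-r^{(l)}}\big)^2}$, using any decomposition $A^{(l)}_s(k)=U\begin{bmatrix}\lambda^{(l)}_1&\nu^{(l)}\\0&\lambda^{(l)}_2\end{bmatrix}U^*$ with $U$ unitary, $\lambda^{(l)}_1\ge\lambda^{(l)}_2$, and $r^{(l)}=|\lambda^{(l)}_2|/|\lambda^{(l)}_1|\in[0,1]$. *)

theory Defs
  imports "HOL-Analysis.Analysis" "HOL-Library.Extended_Nat"
begin

section \<open>Elementwise operations\<close>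

definition sigm :: "real \<Rightarrow> real" where
  "sigm w = 1 / (1 + exp (- w))"

definition vmap :: "(real \<Rightarrow> real) \<Rightarrow> real^'n \<Rightarrow> real^'n" where
  "vmap f v = (\<chi> j. f (v $ j))"

definition had :: "real^'n \<Rightarrow> real^'n \<Rightarrow> real^'n" where
  "had a b = (\<chi> j. a $ j * b $ j)"

text \<open>|A| 1 : row sums of the entrywise absolute value\<close>
definition absrowsum :: "real^'n::finite^'m \<Rightarrow> real^'m" where
  "absrowsum M = (\<chi> i. \<Sum>j\<in>UNIV. \<bar>M $ i $ j\<bar>)"

text \<open>induced 2-norm (operator norm w.r.t. Euclidean norms)\<close>
definition opnorm :: "real^'n::finite^'m::finite \<Rightarrow> real" where
  "opnorm M = onorm (\<lambda>v. M *v v)"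

section \<open>LSTM\<close>

record ('i, 'c) lstm_layer =
  Wf :: "real^'i^'c"  Wi :: "real^'i^'c"  Wc :: "real^'i^'c"  Wo :: "real^'i^'c"
  Uf :: "real^'c^'c"  Ui :: "real^'c^'c"  Uc :: "real^'c^'c"  Uo :: "real^'c^'c"
  bf :: "real^'c"  bi :: "real^'c"  bc :: "real^'c"  bo :: "real^'c"

text \<open>one layer update: input x^{(l)}(t), state (c(t),h(t)) \<mapsto> (c(t+1),h(t+1))\<close>
definition cell :: "('i::finite, 'c::finite) lstm_layer \<Rightarrow> real^'i \<Rightarrow> (real^'c) \<times> (real^'c)
    \<Rightarrow> (real^'c) \<times> (real^'c)" where
  "cell P x s = (let c = fst s; h = snd s;
      fg = vmap sigm (Wf P *v x + Uf P *v h + bf P);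
      ig = vmap sigm (Wi P *v x + Ui P *v h + bi P);
      cg = vmap tanh (Wc P *v x + Uc P *v h + bc P);
      og = vmap sigm (Wo P *v x + Uo P *v h + bo P);
      c' = had fg c + had ig cg
    in (c', had og (vmap tanh c')))"

text \<open>State s = (s^{(1)},...,s^{(L)}) is a function of the layer index l (only l in [1..L] matters).
  P1: parameters of layer 1, Ps l: parameters of layer l >= 2.\<close>
fun layer_state :: "('x::finite, 'c::finite) lstm_layer \<Rightarrow> (nat \<Rightarrow> ('c, 'c) lstm_layer) \<Rightarrow> real^'x
    \<Rightarrow> (nat \<Rightarrow> (real^'c) \<times> (real^'c)) \<Rightarrow> nat \<Rightarrow> (real^'c) \<times> (real^'c)" where
  "layer_state P1 Ps x s 0 = s 0"
| "layer_state P1 Ps x s (Suc 0) = cell P1 x (s 1)"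
| "layer_state P1 Ps x s (Suc (Suc l)) =
     cell (Ps (Suc (Suc l))) (snd (layer_state P1 Ps x s (Suc l))) (s (Suc (Suc l)))"

fun traj :: "('x::finite, 'c::finite) lstm_layer \<Rightarrow> (nat \<Rightarrow> ('c, 'c) lstm_layer) \<Rightarrow> (nat \<Rightarrow> real^'x)
    \<Rightarrow> (nat \<Rightarrow> (real^'c) \<times> (real^'c)) \<Rightarrow> nat \<Rightarrow> (nat \<Rightarrow> (real^'c) \<times> (real^'c))" where
  "traj P1 Ps x s0 0 = s0"
| "traj P1 Ps x s0 (Suc t) = layer_state P1 Ps (x t) (traj P1 Ps x s0 t)"

text \<open>y(t, s(0), x(0:t))\<close>
definition lstm_out :: "('x::finite, 'c::finite) lstm_layer \<Rightarrow> (nat \<Rightarrow> ('c, 'c) lstm_layer)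
    \<Rightarrow> real^'c^'y::finite \<Rightarrow> real^'y \<Rightarrow> nat \<Rightarrow> (nat \<Rightarrow> real^'x)
    \<Rightarrow> (nat \<Rightarrow> (real^'c) \<times> (real^'c)) \<Rightarrow> nat \<Rightarrow> real^'y" where
  "lstm_out P1 Ps Uy b_y L x s0 t = Uy *v snd (traj P1 Ps x s0 t L) + b_y"

text \<open>least element of a set of naturals, infinity if empty\<close>
definition least_enat :: "nat set \<Rightarrow> enat" where
  "least_enat R = (if R = {} then \<infinity> else enat (LEAST t. t \<in> R))"

definition recovery_time :: "('x::finite, 'c::finite) lstm_layer \<Rightarrow> (nat \<Rightarrow> ('c, 'c) lstm_layer)
    \<Rightarrow> real^'c^'y::finite \<Rightarrow> real^'y \<Rightarrow> nat \<Rightarrow> (nat \<Rightarrow> real^'x) \<Rightarrow> (nat \<Rightarrow> real^'x)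
    \<Rightarrow> (nat \<Rightarrow> (real^'c) \<times> (real^'c)) \<Rightarrow> nat \<Rightarrow> real \<Rightarrow> enat" where
  "recovery_time P1 Ps Uy b_y L x xh s0 t0 e =
     (let R = {t. t \<ge> t0 \<and> (\<forall>t'\<ge>t. norm (lstm_out P1 Ps Uy b_y L x s0 t' - lstm_out P1 Ps Uy b_y L xh s0 t') \<le> e)}
      in if R = {} then \<infinity> else enat ((LEAST t. t \<in> R) - t0))"

section \<open>Bounds\<close>

definition Gplus :: "real^'i::finite^'c::finite \<Rightarrow> real^'c^'c \<Rightarrow> real^'c \<Rightarrow> real \<Rightarrow> real \<Rightarrow> real" where
  "Gplus W U b xm \<eta> = infnorm (\<chi> i. max 0 (xm * absrowsum W $ i + \<eta> * absrowsum U $ i + b $ i))"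

definition Gabs :: "real^'i::finite^'c::finite \<Rightarrow> real^'c^'c \<Rightarrow> real^'c \<Rightarrow> real \<Rightarrow> real \<Rightarrow> real" where
  "Gabs W U b xm \<eta> = infnorm (\<chi> i. xm * absrowsum W $ i + \<eta> * absrowsum U $ i + \<bar>b $ i\<bar>)"

definition cbar_of :: "('i::finite, 'c::finite) lstm_layer \<Rightarrow> real \<Rightarrow> real \<Rightarrow> real" where
  "cbar_of P xm \<eta> = sigm (Gplus (Wi P) (Ui P) (bi P) xm \<eta>) * tanh (Gabs (Wc P) (Uc P) (bc P) xm \<eta>)
                     / (1 - sigm (Gplus (Wf P) (Uf P) (bf P) xm \<eta>))"

definition eta_next :: "('i::finite, 'c::finite) lstm_layer \<Rightarrow> real \<Rightarrow> real \<Rightarrow> real" where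
  "eta_next P xm \<eta> = tanh (cbar_of P xm \<eta>) * sigm (Gplus (Wo P) (Uo P) (bo P) xm \<eta>)"

text \<open>eta_prev P xm k = \<eta>(k-1), with \<eta>(-1) = 1\<close>
definition eta_prev :: "('i::finite, 'c::finite) lstm_layer \<Rightarrow> real \<Rightarrow> nat \<Rightarrow> real" where
  "eta_prev P xm k = (eta_next P xm ^^ k) 1"

definition sig_f :: "('i::finite, 'c::finite) lstm_layer \<Rightarrow> real \<Rightarrow> nat \<Rightarrow> real" where
  "sig_f P xm k = sigm (Gplus (Wf P) (Uf P) (bf P) xm (eta_prev P xm k))"
definition sig_i :: "('i::finite, 'c::finite) lstm_layer \<Rightarrow> real \<Rightarrow> nat \<Rightarrow> real" where
  "sig_i P xm k = sigm (Gplus (Wi P) (Ui P) (bi P) xm (eta_prev P xm k))"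
definition sig_o :: "('i::finite, 'c::finite) lstm_layer \<Rightarrow> real \<Rightarrow> nat \<Rightarrow> real" where
  "sig_o P xm k = sigm (Gplus (Wo P) (Uo P) (bo P) xm (eta_prev P xm k))"
definition phi_c :: "('i::finite, 'c::finite) lstm_layer \<Rightarrow> real \<Rightarrow> nat \<Rightarrow> real" where
  "phi_c P xm k = tanh (Gabs (Wc P) (Uc P) (bc P) xm (eta_prev P xm k))"
definition cbar :: "('i::finite, 'c::finite) lstm_layer \<Rightarrow> real \<Rightarrow> nat \<Rightarrow> real" where
  "cbar P xm k = sig_i P xm k * phi_c P xm k / (1 - sig_f P xm k)"

definition alpha_s :: "('i::finite, 'c::finite) lstm_layer \<Rightarrow> real \<Rightarrow> nat \<Rightarrow> real" where
  "alpha_s P xm k = 1/4 * opnorm (Uf P) * cbar P xm k + sig_i P xm k * opnorm (Uc P)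
                    + 1/4 * opnorm (Ui P) * phi_c P xm k"

definition A_s :: "('i::finite, 'c::finite) lstm_layer \<Rightarrow> real \<Rightarrow> nat \<Rightarrow> real^2^2" where
  "A_s P xm k = (\<chi> i j.
     if i = 1 then (if j = 1 then sig_f P xm k else alpha_s P xm k)
     else (if j = 1 then sig_o P xm k * sig_f P xm k
           else alpha_s P xm k * sig_o P xm k + 1/4 * tanh (cbar P xm k) * opnorm (Uo P)))"

definition alpha_x :: "('i::finite, 'c::finite) lstm_layer \<Rightarrow> real \<Rightarrow> nat \<Rightarrow> real" where
  "alpha_x P xm k = 1/4 * opnorm (Wf P) * cbar P xm k + sig_i P xm k * opnorm (Wc P)
                    + 1/4 * opnorm (Wi P) * phi_c P xm k"

definition a_x :: "('i::finite, 'c::finite) lstm_layer \<Rightarrow> real \<Rightarrow> nat \<Rightarrow> real^2" where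
  "a_x P xm k = vector [alpha_x P xm k,
                        alpha_x P xm k * sig_o P xm k + 1/4 * tanh (cbar P xm k) * opnorm (Wo P)]"

definition sbar :: "('i::finite, 'c::finite) lstm_layer \<Rightarrow> real \<Rightarrow> nat \<Rightarrow> real" where
  "sbar P xm k = norm (vector [cbar P xm k, tanh (cbar P xm k) * sig_o P xm k] :: real^2)"

text \<open>Layer dispatch: layer 1 uses P1 and x_max, layers l >= 2 use Ps l and 1.\<close>
definition cbarL where "cbarL P1 Ps xmax k l = (if l = 1 then cbar P1 xmax k else cbar (Ps l) 1 k)"
definition sig_oL where "sig_oL P1 Ps xmax k l = (if l = 1 then sig_o P1 xmax k else sig_o (Ps l) 1 k)"
definition A_sL where "A_sL P1 Ps xmax k l = (if l = 1 then A_s P1 xmax k else A_s (Ps l) 1 k)"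
definition a_xL where "a_xL P1 Ps xmax k l = (if l = 1 then a_x P1 xmax k else a_x (Ps l) 1 k)"
definition sbarL where "sbarL P1 Ps xmax k l = (if l = 1 then sbar P1 xmax k else sbar (Ps l) 1 k)"

text \<open>The set \<Prod>_l S^{(l)}(k) of initial states\<close>
definition init_set :: "('x::finite, 'c::finite) lstm_layer \<Rightarrow> (nat \<Rightarrow> ('c, 'c) lstm_layer) \<Rightarrow> real
    \<Rightarrow> nat \<Rightarrow> nat \<Rightarrow> (nat \<Rightarrow> (real^'c) \<times> (real^'c)) set" where
  "init_set P1 Ps xmax k L = {s0. \<forall>l\<in>{1..L}.
      infnorm (fst (s0 l)) \<le> cbarL P1 Ps xmax k l \<and>
      infnorm (snd (s0 l)) \<le> tanh (cbarL P1 Ps xmax k l) * sig_oL P1 Ps xmax k l}"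

section \<open>Spectral radius, Schur decomposition, beta\<close>

definition cmat :: "real^'n^'m \<Rightarrow> complex^'n^'m" where
  "cmat A = (\<chi> i j. complex_of_real (A $ i $ j))"

definition cadj :: "complex^'n^'m \<Rightarrow> complex^'m^'n" where
  "cadj A = (\<chi> i j. cnj (A $ j $ i))"

definition spec_rad :: "complex^'n::finite^'n \<Rightarrow> real" where
  "spec_rad A = Sup {cmod z | z. \<exists>v. v \<noteq> 0 \<and> A *v v = z *s v}"

text \<open>A = U [[lam1, nu],[0, lam2]] U^* with U unitary and lam1 >= lam2\<close>
definition schur2 :: "real^2^2 \<Rightarrow> complex^2^2 \<Rightarrow> real \<Rightarrow> complex \<Rightarrow> real \<Rightarrow> bool" where
  "schur2 A U lam1 nu lam2 \<longleftrightarrow>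
     U ** cadj U = mat 1 \<and> cadj U ** U = mat 1 \<and>
     cmat A = U ** (\<chi> i j. if i = 1 \<and> j = 1 then complex_of_real lam1
                           else if i = 1 \<and> j = 2 then nu
                           else if i = 2 \<and> j = 2 then complex_of_real lam2 else 0) ** cadj U \<and>
     lam1 \<ge> lam2"

definition mu_fn :: "real \<Rightarrow> complex \<Rightarrow> real \<Rightarrow> nat \<Rightarrow> real" where
  "mu_fn lam1 nu lam2 t = (let r = \<bar>lam2\<bar> / \<bar>lam1\<bar> in
     sqrt ((1 + r ^ (2 * t)) + (cmod nu)\<^sup>2 / \<bar>lam1\<bar>\<^sup>2
            * (if r = 1 then real t else (1 - r ^ t) / (1 - r))\<^sup>2))"

text \<open>beta-tilde; rho l, mu l t, axn l = ||a_x^{(l)}(k)||, s l = s^{(l)}\<close>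
definition beta_tilde :: "nat \<Rightarrow> (nat \<Rightarrow> real) \<Rightarrow> (nat \<Rightarrow> nat \<Rightarrow> real) \<Rightarrow> (nat \<Rightarrow> real)
    \<Rightarrow> (nat \<Rightarrow> real) \<Rightarrow> nat \<Rightarrow> real" where
  "beta_tilde L rho mu axn s t =
     mu L t * rho L ^ t * s L +
     (\<Sum>l\<in>{1..<L}. (\<Prod>i\<in>{l..L}. mu i t) * (fact (t + L - l) / (fact t * fact (L - l)))
         * (MAX i\<in>{l..L}. rho i ^ t) * (\<Prod>i\<in>{l+1..L}. axn i) * s l)"

end

theory Submission
  imports Defs
begin

text \<open>On the box \<open>\<S>(k)\<close> the gate preactivations are bounded through the decreasing sequence
  \<open>\<eta>(k)\<close>, so every cell maps \<open>\<S>(k)\<close> into itself and is Lipschitz there. Hence the pair of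
  errors \<open>E = (\<parallel>\<Delta>c\<parallel>, \<parallel>\<Delta>h\<parallel>)\<close> of a layer obeys the componentwise recursion
  \<open>E(\<tau>+1) \<le> A\<^sub>s E(\<tau>) + \<parallel>\<Delta>x\<parallel> a\<^sub>x\<close> with a nonnegative matrix \<open>A\<^sub>s\<close>, where \<open>\<Delta>x\<close> is the input
  error (zero after \<open>t\<^sub>0\<close>) for the first layer and the hidden-state error of the layer below
  otherwise. The Schur form of \<open>A\<^sub>s\<close> bounds its powers by \<open>\<mu>(t) \<lambda>\<^sub>1\<^sup>\<tau>\<close> with
  \<open>\<lambda>\<^sub>1 \<le> \<rho>(A\<^sub>s)\<close>. Unrolling the recursions layer by layer, the convolutions are collected by the
  hockey-stick identity into \<open>\<beta>\<close>, and the output error is at most \<open>\<parallel>U\<^sub>y\<parallel>\<close> times the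
  error of the top layer.\<close>

section \<open>Activation functions\<close>

lemma sigm_pos: "0 < sigm w"
  by (simp add: sigm_def add_pos_pos)

lemma sigm_less_1: "sigm w < 1"
  unfolding sigm_def by (simp add: divide_less_eq add_pos_pos)

lemma sigm_mono: "a \<le> b \<Longrightarrow> sigm a \<le> sigm b"
  unfolding sigm_def by (simp add: frac_le add_pos_pos)

lemma has_real_derivative_sigm: "(sigm has_real_derivative sigm x * (1 - sigm x)) (at x)"
proof -
  have ne: "1 + exp (- x) \<noteq> 0"
    using exp_gt_zero[of "- x"] by linarith
  have "((\<lambda>w. 1 / (1 + exp (- w))) has_real_derivative exp (- x) / (1 + exp (- x))\<^sup>2) (at x)"
    by (rule derivative_eq_intros refl | simp add: ne)+ (simp add: power2_eq_square field_simps ne)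
  moreover have "exp (- x) / (1 + exp (- x))\<^sup>2 = sigm x * (1 - sigm x)"
    unfolding sigm_def by (simp add: field_simps power2_eq_square ne)
  ultimately show ?thesis
    unfolding sigm_def[abs_def] by simp
qed

lemma sigm_lipschitz: "\<bar>sigm a - sigm b\<bar> \<le> 1/4 * \<bar>a - b\<bar>"
proof -
  have "norm (sigm a - sigm b) \<le> 1/4 * norm (a - b)"
  proof (rule field_differentiable_bound[OF convex_UNIV])
    fix x :: real
    show "(sigm has_field_derivative sigm x * (1 - sigm x)) (at x within UNIV)"
      by (rule has_real_derivative_sigm)
    have "sigm x * (1 - sigm x) = 1/4 - (sigm x - 1/2)\<^sup>2"
      by (simp add: power2_eq_square algebra_simps)
    moreover have "0 \<le> sigm x * (1 - sigm x)"
      using sigm_pos[of x] sigm_less_1[of x] by simp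
    ultimately show "norm (sigm x * (1 - sigm x)) \<le> 1/4"
      using zero_le_power2[of "sigm x - 1/2"] by simp
  qed auto
  then show ?thesis by simp
qed

lemma tanh_lipschitz: "\<bar>tanh a - tanh b\<bar> \<le> \<bar>a - b\<bar>" for a b :: real
proof -
  have "norm (tanh a - tanh b) \<le> 1 * norm (a - b)"
  proof (rule field_differentiable_bound[OF convex_UNIV])
    fix x :: real
    show "(tanh has_field_derivative 1 - tanh x ^ 2) (at x within UNIV)"
      using cosh_real_pos[of x] by (auto intro!: derivative_eq_intros)
    have "tanh x ^ 2 \<le> 1"
      using tanh_real_bounds[of x] by (auto simp: abs_square_le_1 abs_le_iff)
    then show "norm (1 - tanh x ^ 2) \<le> 1" by simp
  qed auto
  then show ?thesis by simp
qed

lemma abs_tanh_le: "\<bar>x\<bar> \<le> B \<Longrightarrow> \<bar>tanh x\<bar> \<le> tanh B" for x B :: real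
  by (metis tanh_real_abs tanh_real_le_iff)

lemma abs_sigm_tanh_le_1: "\<bar>sigm u * tanh v\<bar> \<le> 1"
proof -
  have "\<bar>sigm u\<bar> \<le> 1" "\<bar>tanh v\<bar> \<le> 1"
    using sigm_pos[of u] sigm_less_1[of u] tanh_real_bounds[of v] by auto
  then show ?thesis
    by (metis abs_ge_zero abs_mult mult_le_one)
qed


section \<open>Vector estimates\<close>

lemma infnorm_le_iff_cart: "infnorm (v::real^'n) \<le> B \<longleftrightarrow> (\<forall>i. \<bar>v $ i\<bar> \<le> B)"
proof
  show "\<forall>i. \<bar>v $ i\<bar> \<le> B" if "infnorm v \<le> B"
    using that component_le_infnorm_cart order_trans by blast
  show "infnorm v \<le> B" if "\<forall>i. \<bar>v $ i\<bar> \<le> B"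
    using that unfolding infnorm_cart by (intro cSup_least) auto
qed

lemma infnorm_mono_cart:
  assumes "\<And>i. \<bar>u $ i\<bar> \<le> \<bar>v $ i\<bar>"
  shows "infnorm (u::real^'n) \<le> infnorm v"
  using assms component_le_infnorm_cart order_trans unfolding infnorm_le_iff_cart by blast

lemma norm_vec_2: "norm (v :: 'a::real_normed_vector^2) = sqrt ((norm (v $ 1))\<^sup>2 + (norm (v $ 2))\<^sup>2)"
  unfolding norm_vec_def L2_set_def by (simp add: sum_2)

lemma norm_le_sqrt_CARD:
  assumes "\<And>i. \<bar>(v::real^'n) $ i\<bar> \<le> B"
  shows "norm v \<le> sqrt (real CARD('n)) * B"
proof -
  have "norm v \<le> sqrt (real DIM(real^'n)) * infnorm v" by (rule norm_le_infnorm)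
  also have "\<dots> \<le> sqrt (real CARD('n)) * B"
    using assms by (simp add: mult_left_mono infnorm_le_iff_cart)
  finally show ?thesis .
qed

lemma vec_nth_le_norm: "(v::real^'n) $ i \<le> norm v"
  by (metis abs_ge_self component_le_norm_cart order_trans real_norm_def)

lemma norm_had_le:
  assumes "\<And>i. \<bar>a $ i\<bar> \<le> B"
  shows "norm (had a b) \<le> B * norm (b::real^'n)"
proof -
  have B: "0 \<le> B" using assms[of undefined] by linarith
  have "norm (had a b) \<le> norm (B *\<^sub>R b)"
    by (rule norm_le_componentwise_cart)
       (auto simp: had_def abs_mult B intro!: mult_right_mono assms)
  then show ?thesis using B by simp
qed

lemma had_diff: "had a b - had a' b' = had a (b - b') + had b' (a - a')"
  by (simp add: had_def vec_eq_iff algebra_simps)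

lemma norm_vmap_diff_le:
  assumes "\<And>u v. \<bar>f u - f v\<bar> \<le> K * \<bar>u - v\<bar>" and "0 \<le> K"
  shows "norm (vmap f u - vmap f v) \<le> K * norm (u - v :: real^'n)"
proof -
  have "norm (vmap f u - vmap f v) \<le> norm (K *\<^sub>R (u - v))"
    by (rule norm_le_componentwise_cart) (auto simp: vmap_def abs_mult \<open>0 \<le> K\<close> intro: assms(1))
  then show ?thesis using \<open>0 \<le> K\<close> by simp
qed

lemma norm_mult_vec_le_opnorm: "norm (M *v v) \<le> opnorm M * norm v"
  for M :: "real^'n::finite^'m::finite"
  unfolding opnorm_def by (rule onorm) simp

lemma opnorm_nonneg: "0 \<le> opnorm (M :: real^'n::finite^'m::finite)"
  unfolding opnorm_def by (rule onorm_pos_le) simp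


section \<open>The invariant box of one cell\<close>

lemma absrowsum_nonneg: "0 \<le> absrowsum W $ i"
  by (simp add: absrowsum_def sum_nonneg)

lemma abs_matrix_vector_mult_le_absrowsum:
  fixes W :: "real^'i::finite^'c::finite"
  assumes "\<And>j. \<bar>x $ j\<bar> \<le> xm"
  shows "\<bar>(W *v x) $ i\<bar> \<le> xm * absrowsum W $ i"
proof -
  have "\<bar>(W *v x) $ i\<bar> \<le> (\<Sum>j\<in>UNIV. \<bar>W $ i $ j\<bar> * \<bar>x $ j\<bar>)"
    unfolding matrix_vector_mult_def by (simp add: abs_mult[symmetric] sum_abs)
  also have "\<dots> \<le> (\<Sum>j\<in>UNIV. \<bar>W $ i $ j\<bar> * xm)"
    by (intro sum_mono mult_left_mono assms) simp
  also have "\<dots> = xm * absrowsum W $ i"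
    by (simp add: absrowsum_def sum_distrib_left mult.commute)
  finally show ?thesis .
qed

lemma preactivation_bounds:
  fixes W :: "real^'i::finite^'c::finite" and U :: "real^'c^'c"
  assumes "\<And>j. \<bar>x $ j\<bar> \<le> xm" and "\<And>j. \<bar>h $ j\<bar> \<le> \<eta>"
  shows "(W *v x + U *v h + b) $ i \<le> Gplus W U b xm \<eta>"
    and "\<bar>(W *v x + U *v h + b) $ i\<bar> \<le> Gabs W U b xm \<eta>"
proof -
  let ?a = "xm * absrowsum W $ i + \<eta> * absrowsum U $ i"
  have a: "\<bar>(W *v x) $ i\<bar> + \<bar>(U *v h) $ i\<bar> \<le> ?a"
    using assms by (intro add_mono abs_matrix_vector_mult_le_absrowsum)
  have "?a + b $ i \<le> Gplus W U b xm \<eta>"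
    using component_le_infnorm_cart[of "\<chi> i. max 0 (xm * absrowsum W $ i + \<eta> * absrowsum U $ i + b $ i)" i]
    unfolding Gplus_def by simp
  then show "(W *v x + U *v h + b) $ i \<le> Gplus W U b xm \<eta>"
    using a by simp
  have "?a + \<bar>b $ i\<bar> \<le> Gabs W U b xm \<eta>"
    using component_le_infnorm_cart[of "\<chi> i. xm * absrowsum W $ i + \<eta> * absrowsum U $ i + \<bar>b $ i\<bar>" i]
    unfolding Gabs_def by simp
  then show "\<bar>(W *v x + U *v h + b) $ i\<bar> \<le> Gabs W U b xm \<eta>"
    using a by simp
qed

lemma Gabs_nonneg: "0 \<le> Gabs W U b xm \<eta>"
  unfolding Gabs_def by (rule infnorm_pos_le)

lemma Gplus_mono:
  assumes "\<eta> \<le> \<eta>'"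
  shows "Gplus W U b xm \<eta> \<le> Gplus W U b xm \<eta>'"
proof -
  have "max 0 (xm * absrowsum W $ i + \<eta> * absrowsum U $ i + b $ i)
      \<le> max 0 (xm * absrowsum W $ i + \<eta>' * absrowsum U $ i + b $ i)" for i
    by (rule max.mono[OF order_refl add_right_mono[OF add_left_mono]])
       (rule mult_right_mono[OF assms absrowsum_nonneg])
  then show ?thesis
    unfolding Gplus_def by (intro infnorm_mono_cart) simp
qed

lemma Gabs_mono:
  assumes "\<eta> \<le> \<eta>'" and "0 \<le> \<eta>" and "0 \<le> xm"
  shows "Gabs W U b xm \<eta> \<le> Gabs W U b xm \<eta>'"
proof -
  have "\<bar>xm * absrowsum W $ i + \<eta> * absrowsum U $ i + \<bar>b $ i\<bar>\<bar>
      \<le> \<bar>xm * absrowsum W $ i + \<eta>' * absrowsum U $ i + \<bar>b $ i\<bar>\<bar>" for i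
    using assms absrowsum_nonneg[of W i] absrowsum_nonneg[of U i]
    by (simp add: mult_right_mono)
  then show ?thesis
    unfolding Gabs_def by (intro infnorm_mono_cart) simp
qed

lemma cbar_of_nonneg: "0 \<le> cbar_of P xm \<eta>"
  unfolding cbar_of_def
  by (intro divide_nonneg_pos mult_nonneg_nonneg)
     (simp_all add: less_imp_le[OF sigm_pos] Gabs_nonneg sigm_less_1)

lemma cbar_of_mono:
  assumes "0 \<le> \<eta>" and "\<eta> \<le> \<eta>'" and "0 \<le> xm"
  shows "cbar_of P xm \<eta> \<le> cbar_of P xm \<eta>'"
proof -
  let ?i = "\<lambda>\<eta>. sigm (Gplus (Wi P) (Ui P) (bi P) xm \<eta>)"
    and ?c = "\<lambda>\<eta>. tanh (Gabs (Wc P) (Uc P) (bc P) xm \<eta>)"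
    and ?f = "\<lambda>\<eta>. sigm (Gplus (Wf P) (Uf P) (bf P) xm \<eta>)"
  have "0 \<le> ?c \<eta>" "?c \<eta> \<le> ?c \<eta>'"
    using Gabs_nonneg Gabs_mono[OF assms(2,1,3)] by simp_all
  then have "?i \<eta> * ?c \<eta> \<le> ?i \<eta>' * ?c \<eta>'" "0 \<le> ?i \<eta> * ?c \<eta>"
    using sigm_mono[OF Gplus_mono[OF assms(2)]] sigm_pos
    by (auto intro!: mult_mono simp: less_imp_le)
  moreover have "0 < 1 - ?f \<eta>'" "1 - ?f \<eta>' \<le> 1 - ?f \<eta>"
    using sigm_mono[OF Gplus_mono[OF assms(2)]] sigm_less_1 by auto
  ultimately show ?thesis
    unfolding cbar_of_def by (meson frac_le order_trans less_imp_le)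
qed

lemma eta_next_nonneg: "0 \<le> eta_next P xm \<eta>"
  unfolding eta_next_def
  by (intro mult_nonneg_nonneg) (simp_all add: cbar_of_nonneg less_imp_le[OF sigm_pos])

lemma eta_next_le_1: "eta_next P xm \<eta> \<le> 1"
  using abs_sigm_tanh_le_1[of "Gplus (Wo P) (Uo P) (bo P) xm \<eta>" "cbar_of P xm \<eta>"]
  by (simp add: eta_next_def abs_le_iff mult.commute)

lemma eta_next_mono:
  assumes "0 \<le> \<eta>" and "\<eta> \<le> \<eta>'" and "0 \<le> xm"
  shows "eta_next P xm \<eta> \<le> eta_next P xm \<eta>'"
  unfolding eta_next_def
  using cbar_of_mono[OF assms] sigm_mono[OF Gplus_mono[OF assms(2)]] cbar_of_nonneg sigm_pos
  by (intro mult_mono) (auto simp: less_imp_le)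

lemma eta_prev_Suc: "eta_prev P xm (Suc k) = eta_next P xm (eta_prev P xm k)"
  by (simp add: eta_prev_def)

lemma eta_prev_nonneg: "0 \<le> eta_prev P xm k"
  by (cases k) (auto simp: eta_prev_def eta_next_nonneg)

text \<open>The bounds \<open>\<eta>(k)\<close> decrease because \<open>\<eta>(0) \<le> 1 = \<eta>(-1)\<close> and the update is monotone.\<close>

lemma eta_prev_Suc_le: "0 \<le> xm \<Longrightarrow> eta_prev P xm (Suc k) \<le> eta_prev P xm k"
proof (induction k)
  case 0
  then show ?case by (simp add: eta_prev_def eta_next_le_1)
next
  case (Suc k)
  then show ?case
    by (simp only: eta_prev_Suc[of P xm "Suc k"] eta_prev_Suc[of P xm k])
       (intro eta_next_mono; simp add: eta_prev_nonneg flip: eta_prev_Suc)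
qed

lemma sig_f_pos: "0 < sig_f P xm k" and sig_f_less_1: "sig_f P xm k < 1"
  and sig_i_pos: "0 < sig_i P xm k" and sig_o_pos: "0 < sig_o P xm k"
  by (auto simp: sig_f_def sig_i_def sig_o_def sigm_pos sigm_less_1)

lemma phi_c_nonneg: "0 \<le> phi_c P xm k"
  by (simp add: phi_c_def Gabs_nonneg)

lemma cbar_nonneg: "0 \<le> cbar P xm k"
  unfolding cbar_def
  by (intro divide_nonneg_pos mult_nonneg_nonneg)
     (simp_all add: less_imp_le[OF sig_i_pos] phi_c_nonneg sig_f_less_1)

lemma cbar_fixpoint: "sig_f P xm k * cbar P xm k + sig_i P xm k * phi_c P xm k = cbar P xm k"
proof -
  have "1 - sig_f P xm k \<noteq> 0" using sig_f_less_1[of P xm k] by simp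
  then show ?thesis unfolding cbar_def by (simp add: field_simps)
qed

definition hbar :: "('i::finite, 'c::finite) lstm_layer \<Rightarrow> real \<Rightarrow> nat \<Rightarrow> real" where
  "hbar P xm k = tanh (cbar P xm k) * sig_o P xm k"

lemma eta_prev_Suc_eq_hbar: "eta_prev P xm (Suc k) = hbar P xm k"
  by (simp add: eta_prev_Suc eta_next_def hbar_def cbar_def cbar_of_def
      sig_i_def sig_f_def phi_c_def sig_o_def)

lemma hbar_le_eta_prev: "0 \<le> xm \<Longrightarrow> hbar P xm k \<le> eta_prev P xm k"
  using eta_prev_Suc_le[of xm P k] by (simp add: eta_prev_Suc_eq_hbar)

lemma fst_cell: "fst (cell P x (c, h)) = had (vmap sigm (Wf P *v x + Uf P *v h + bf P)) c
    + had (vmap sigm (Wi P *v x + Ui P *v h + bi P)) (vmap tanh (Wc P *v x + Uc P *v h + bc P))"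
  by (simp add: cell_def Let_def)

lemma snd_cell: "snd (cell P x (c, h))
    = had (vmap sigm (Wo P *v x + Uo P *v h + bo P)) (vmap tanh (fst (cell P x (c, h))))"
  by (simp add: cell_def Let_def)

lemma abs_snd_cell_le_1: "\<bar>snd (cell P x s) $ j\<bar> \<le> 1"
  by (cases s) (simp add: snd_cell had_def vmap_def abs_sigm_tanh_le_1)

lemma gate_bounds:
  fixes P :: "('i::finite, 'c::finite) lstm_layer"
  assumes "0 \<le> xm" and x: "\<And>j. \<bar>x $ j\<bar> \<le> xm" and "\<And>j. \<bar>h $ j\<bar> \<le> hbar P xm k"
  shows "\<bar>vmap sigm (Wf P *v x + Uf P *v h + bf P) $ i\<bar> \<le> sig_f P xm k"
    and "\<bar>vmap sigm (Wi P *v x + Ui P *v h + bi P) $ i\<bar> \<le> sig_i P xm k"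
    and "\<bar>vmap sigm (Wo P *v x + Uo P *v h + bo P) $ i\<bar> \<le> sig_o P xm k"
    and "\<bar>vmap tanh (Wc P *v x + Uc P *v h + bc P) $ i\<bar> \<le> phi_c P xm k"
proof -
  have h: "\<And>j. \<bar>h $ j\<bar> \<le> eta_prev P xm k"
    using assms hbar_le_eta_prev order_trans by blast
  note pre = preactivation_bounds[OF x h]
  show "\<bar>vmap sigm (Wf P *v x + Uf P *v h + bf P) $ i\<bar> \<le> sig_f P xm k"
    "\<bar>vmap sigm (Wi P *v x + Ui P *v h + bi P) $ i\<bar> \<le> sig_i P xm k"
    "\<bar>vmap sigm (Wo P *v x + Uo P *v h + bo P) $ i\<bar> \<le> sig_o P xm k"
    using sigm_mono[OF pre(1)] sigm_pos
    by (simp_all add: vmap_def sig_f_def sig_i_def sig_o_def less_imp_le)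
  show "\<bar>vmap tanh (Wc P *v x + Uc P *v h + bc P) $ i\<bar> \<le> phi_c P xm k"
    unfolding vmap_def phi_c_def vec_lambda_beta by (rule abs_tanh_le[OF pre(2)])
qed

definition in_S :: "('i::finite, 'c::finite) lstm_layer \<Rightarrow> real \<Rightarrow> nat \<Rightarrow> (real^'c) \<times> (real^'c) \<Rightarrow> bool"
  where "in_S P xm k s \<longleftrightarrow> (\<forall>j. \<bar>fst s $ j\<bar> \<le> cbar P xm k) \<and> (\<forall>j. \<bar>snd s $ j\<bar> \<le> hbar P xm k)"

lemma cell_in_S:
  fixes P :: "('i::finite, 'c::finite) lstm_layer"
  assumes xm: "0 \<le> xm" and x: "\<And>j. \<bar>x $ j\<bar> \<le> xm" and s: "in_S P xm k s"
  shows "in_S P xm k (cell P x s)"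
proof -
  obtain c h where s_eq: "s = (c, h)" by fastforce
  have c: "\<And>j. \<bar>c $ j\<bar> \<le> cbar P xm k" and h: "\<And>j. \<bar>h $ j\<bar> \<le> hbar P xm k"
    using s by (auto simp: in_S_def s_eq)
  note g = gate_bounds[OF xm x h]
  have c': "\<bar>fst (cell P x (c, h)) $ j\<bar> \<le> cbar P xm k" for j
  proof -
    let ?f = "vmap sigm (Wf P *v x + Uf P *v h + bf P) $ j"
    let ?i = "vmap sigm (Wi P *v x + Ui P *v h + bi P) $ j"
    let ?g = "vmap tanh (Wc P *v x + Uc P *v h + bc P) $ j"
    have "\<bar>fst (cell P x (c, h)) $ j\<bar> \<le> \<bar>?f\<bar> * \<bar>c $ j\<bar> + \<bar>?i\<bar> * \<bar>?g\<bar>"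
      by (simp add: fst_cell had_def abs_mult[symmetric] abs_triangle_ineq)
    also have "\<dots> \<le> sig_f P xm k * cbar P xm k + sig_i P xm k * phi_c P xm k"
      using g[of j] c[of j] cbar_nonneg phi_c_nonneg by (intro add_mono mult_mono) auto
    also have "\<dots> = cbar P xm k" by (rule cbar_fixpoint)
    finally show ?thesis .
  qed
  have "\<bar>snd (cell P x (c, h)) $ j\<bar> \<le> hbar P xm k" for j
  proof -
    have "\<bar>snd (cell P x (c, h)) $ j\<bar>
        = \<bar>vmap sigm (Wo P *v x + Uo P *v h + bo P) $ j\<bar> * \<bar>tanh (fst (cell P x (c, h)) $ j)\<bar>"
      by (simp add: snd_cell[of P x c h] had_def vmap_def abs_mult)
    also have "\<dots> \<le> sig_o P xm k * tanh (cbar P xm k)"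
      using g(3)[of j] abs_tanh_le[OF c'[of j]] by (intro mult_mono) auto
    finally show ?thesis by (simp add: hbar_def mult.commute)
  qed
  then show ?thesis using c' by (simp add: in_S_def s_eq)
qed


section \<open>Lipschitz estimate for one cell\<close>

lemma norm_gate_diff_le:
  fixes W :: "real^'i::finite^'c::finite" and U :: "real^'c^'c"
  assumes "\<And>u v. \<bar>f u - f v\<bar> \<le> K * \<bar>u - v\<bar>" and "0 \<le> K"
  shows "norm (vmap f (W *v x + U *v h + b) - vmap f (W *v x' + U *v h' + b))
    \<le> K * (opnorm W * norm (x - x') + opnorm U * norm (h - h'))"
proof -
  have "norm (vmap f (W *v x + U *v h + b) - vmap f (W *v x' + U *v h' + b))
      \<le> K * norm (W *v x + U *v h + b - (W *v x' + U *v h' + b))"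
    by (rule norm_vmap_diff_le[OF assms])
  also have "W *v x + U *v h + b - (W *v x' + U *v h' + b) = W *v (x - x') + U *v (h - h')"
    by (simp add: matrix_vector_mult_diff_distrib)
  also have "norm \<dots> \<le> opnorm W * norm (x - x') + opnorm U * norm (h - h')"
    by (rule norm_triangle_le) (intro add_mono norm_mult_vec_le_opnorm)
  finally show ?thesis
    using assms(2) by (simp add: mult_left_mono)
qed

lemma cell_fst_diff_le:
  fixes P :: "('i::finite, 'c::finite) lstm_layer"
  assumes xm: "0 \<le> xm" and x: "\<And>j. \<bar>x $ j\<bar> \<le> xm" and x': "\<And>j. \<bar>x' $ j\<bar> \<le> xm"
    and s: "in_S P xm k (c, h)" and s': "in_S P xm k (c', h')"
  shows "norm (fst (cell P x (c, h)) - fst (cell P x' (c', h')))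
    \<le> sig_f P xm k * norm (c - c') + alpha_s P xm k * norm (h - h') + alpha_x P xm k * norm (x - x')"
proof -
  define F where "F = vmap sigm (Wf P *v x + Uf P *v h + bf P)"
  define F' where "F' = vmap sigm (Wf P *v x' + Uf P *v h' + bf P)"
  define I where "I = vmap sigm (Wi P *v x + Ui P *v h + bi P)"
  define I' where "I' = vmap sigm (Wi P *v x' + Ui P *v h' + bi P)"
  define G where "G = vmap tanh (Wc P *v x + Uc P *v h + bc P)"
  define G' where "G' = vmap tanh (Wc P *v x' + Uc P *v h' + bc P)"
  let ?dx = "norm (x - x')" and ?dh = "norm (h - h')"
  have h: "\<And>j. \<bar>h $ j\<bar> \<le> hbar P xm k"
    and h': "\<And>j. \<bar>h' $ j\<bar> \<le> hbar P xm k" and c': "\<And>j. \<bar>c' $ j\<bar> \<le> cbar P xm k"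
    using s s' by (auto simp: in_S_def)
  have "fst (cell P x (c, h)) - fst (cell P x' (c', h'))
      = had F (c - c') + had c' (F - F') + (had I (G - G') + had G' (I - I'))"
    unfolding fst_cell F_def F'_def I_def I'_def G_def G'_def
    by (simp add: had_diff[symmetric] algebra_simps)
  also have "norm \<dots> \<le> sig_f P xm k * norm (c - c') + cbar P xm k * (1/4 * (opnorm (Wf P) * ?dx + opnorm (Uf P) * ?dh))
      + (sig_i P xm k * (1 * (opnorm (Wc P) * ?dx + opnorm (Uc P) * ?dh))
         + phi_c P xm k * (1/4 * (opnorm (Wi P) * ?dx + opnorm (Ui P) * ?dh)))"
  proof (intro norm_triangle_le add_mono)
    show "norm (had F (c - c')) \<le> sig_f P xm k * norm (c - c')"
      using gate_bounds(1)[OF xm x h] unfolding F_def by (rule norm_had_le)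
    show "norm (had c' (F - F')) \<le> cbar P xm k * (1/4 * (opnorm (Wf P) * ?dx + opnorm (Uf P) * ?dh))"
      unfolding F_def F'_def
      by (rule order_trans[OF norm_had_le[OF c'] mult_left_mono[OF norm_gate_diff_le[OF sigm_lipschitz]]])
         (simp_all add: cbar_nonneg)
    show "norm (had I (G - G')) \<le> sig_i P xm k * (1 * (opnorm (Wc P) * ?dx + opnorm (Uc P) * ?dh))"
      unfolding I_def G_def G'_def
      by (rule order_trans[OF norm_had_le[OF gate_bounds(2)[OF xm x h]]
            mult_left_mono[OF norm_gate_diff_le]])
         (simp_all add: tanh_lipschitz less_imp_le[OF sig_i_pos])
    show "norm (had G' (I - I')) \<le> phi_c P xm k * (1/4 * (opnorm (Wi P) * ?dx + opnorm (Ui P) * ?dh))"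
      unfolding I_def I'_def G'_def
      by (rule order_trans[OF norm_had_le[OF gate_bounds(4)[OF xm x' h']]
            mult_left_mono[OF norm_gate_diff_le[OF sigm_lipschitz]]])
         (simp_all add: phi_c_nonneg)
  qed
  also have "\<dots> = sig_f P xm k * norm (c - c') + alpha_s P xm k * ?dh + alpha_x P xm k * ?dx"
    by (simp add: alpha_s_def alpha_x_def algebra_simps)
  finally show ?thesis .
qed

lemma cell_snd_diff_le:
  fixes P :: "('i::finite, 'c::finite) lstm_layer"
  assumes xm: "0 \<le> xm" and x: "\<And>j. \<bar>x $ j\<bar> \<le> xm" and x': "\<And>j. \<bar>x' $ j\<bar> \<le> xm"
    and s: "in_S P xm k (c, h)" and s': "in_S P xm k (c', h')"
  shows "norm (snd (cell P x (c, h)) - snd (cell P x' (c', h')))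
    \<le> sig_o P xm k * norm (fst (cell P x (c, h)) - fst (cell P x' (c', h')))
      + 1/4 * tanh (cbar P xm k) * (opnorm (Uo P) * norm (h - h') + opnorm (Wo P) * norm (x - x'))"
proof -
  define Og where "Og = vmap sigm (Wo P *v x + Uo P *v h + bo P)"
  define Og' where "Og' = vmap sigm (Wo P *v x' + Uo P *v h' + bo P)"
  define a where "a = fst (cell P x (c, h))"
  define a' where "a' = fst (cell P x' (c', h'))"
  have h: "\<And>j. \<bar>h $ j\<bar> \<le> hbar P xm k"
    using s by (simp add: in_S_def)
  have a': "\<bar>vmap tanh a' $ j\<bar> \<le> tanh (cbar P xm k)" for j
    using cell_in_S[OF xm x' s'] unfolding in_S_def a'_def vmap_def by (auto intro: abs_tanh_le)
  have "snd (cell P x (c, h)) - snd (cell P x' (c', h'))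
      = had Og (vmap tanh a - vmap tanh a') + had (vmap tanh a') (Og - Og')"
    unfolding snd_cell[of P x c h] snd_cell[of P x' c' h'] Og_def Og'_def a_def a'_def
    by (simp add: had_diff)
  also have "norm \<dots> \<le> sig_o P xm k * (1 * norm (a - a'))
      + tanh (cbar P xm k) * (1/4 * (opnorm (Wo P) * norm (x - x') + opnorm (Uo P) * norm (h - h')))"
  proof (intro norm_triangle_le add_mono)
    show "norm (had Og (vmap tanh a - vmap tanh a')) \<le> sig_o P xm k * (1 * norm (a - a'))"
      unfolding Og_def
      by (rule order_trans[OF norm_had_le[OF gate_bounds(3)[OF xm x h]]
            mult_left_mono[OF norm_vmap_diff_le]])
         (simp_all add: tanh_lipschitz less_imp_le[OF sig_o_pos])
    show "norm (had (vmap tanh a') (Og - Og'))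
        \<le> tanh (cbar P xm k) * (1/4 * (opnorm (Wo P) * norm (x - x') + opnorm (Uo P) * norm (h - h')))"
      unfolding Og_def Og'_def
      by (rule order_trans[OF norm_had_le[OF a'] mult_left_mono[OF norm_gate_diff_le[OF sigm_lipschitz]]])
         (simp_all add: cbar_nonneg)
  qed
  finally show ?thesis
    by (simp add: a_def a'_def algebra_simps)
qed

definition state_error :: "(real^'c) \<times> (real^'c) \<Rightarrow> (real^'c) \<times> (real^'c) \<Rightarrow> real^2" where
  "state_error s s' = vector [norm (fst s - fst s'), norm (snd s - snd s')]"

lemma state_error_nonneg: "0 \<le> state_error s s'"
  by (simp add: state_error_def less_eq_vec_def forall_2)

lemma alpha_s_nonneg: "0 \<le> alpha_s P xm k"
  unfolding alpha_s_def
  by (intro add_nonneg_nonneg mult_nonneg_nonneg)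
     (simp_all add: opnorm_nonneg cbar_nonneg less_imp_le[OF sig_i_pos] phi_c_nonneg)

lemma A_s_nonneg: "0 \<le> A_s P xm k $ i $ j"
  using sig_f_pos[of P xm k] sig_o_pos[of P xm k] alpha_s_nonneg[of P xm k]
    opnorm_nonneg[of "Uo P"] cbar_nonneg[of P xm k]
  by (simp add: A_s_def)

lemma A_s_trace_pos: "0 < A_s P xm k $ 1 $ 1 + A_s P xm k $ 2 $ 2"
  using sig_f_pos[of P xm k] A_s_nonneg[of P xm k 2 2] by (simp add: A_s_def)

lemma state_error_cell_le:
  fixes P :: "('i::finite, 'c::finite) lstm_layer"
  assumes xm: "0 \<le> xm" and x: "\<And>j. \<bar>x $ j\<bar> \<le> xm" and x': "\<And>j. \<bar>x' $ j\<bar> \<le> xm"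
    and s: "in_S P xm k s" and s': "in_S P xm k s'"
  shows "state_error (cell P x s) (cell P x' s') \<le> A_s P xm k *v state_error s s' + norm (x - x') *\<^sub>R a_x P xm k"
proof -
  obtain c h c' h' where eq: "s = (c, h)" "s' = (c', h')" by fastforce
  let ?dc = "norm (c - c')" and ?dh = "norm (h - h')" and ?dx = "norm (x - x')"
  let ?rhs = "A_s P xm k *v state_error s s' + ?dx *\<^sub>R a_x P xm k"
  have fst_le: "norm (fst (cell P x (c, h)) - fst (cell P x' (c', h')))
      \<le> sig_f P xm k * ?dc + alpha_s P xm k * ?dh + alpha_x P xm k * ?dx"
    using cell_fst_diff_le[OF xm x x' s[unfolded eq] s'[unfolded eq]] .
  have "norm (snd (cell P x (c, h)) - snd (cell P x' (c', h')))
      \<le> sig_o P xm k * (sig_f P xm k * ?dc + alpha_s P xm k * ?dh + alpha_x P xm k * ?dx)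
        + 1/4 * tanh (cbar P xm k) * (opnorm (Uo P) * ?dh + opnorm (Wo P) * ?dx)"
    using cell_snd_diff_le[OF xm x x' s[unfolded eq] s'[unfolded eq]]
      mult_left_mono[OF fst_le less_imp_le[OF sig_o_pos[of P xm k]]] by linarith
  moreover have "?rhs $ 1 = sig_f P xm k * ?dc + alpha_s P xm k * ?dh + alpha_x P xm k * ?dx"
    by (simp add: eq state_error_def matrix_vector_mult_def sum_2 A_s_def a_x_def mult.commute)
  moreover have "?rhs $ 2 = sig_o P xm k * (sig_f P xm k * ?dc + alpha_s P xm k * ?dh + alpha_x P xm k * ?dx)
      + 1/4 * tanh (cbar P xm k) * (opnorm (Uo P) * ?dh + opnorm (Wo P) * ?dx)"
    by (simp add: eq state_error_def matrix_vector_mult_def sum_2 A_s_def a_x_def algebra_simps)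
  ultimately show ?thesis
    using fst_le unfolding less_eq_vec_def forall_2 by (simp add: eq state_error_def)
qed

lemma norm_state_error_le_sbar:
  fixes P :: "('i::finite, 'c::finite) lstm_layer"
  assumes s: "in_S P xm k s" and s': "in_S P xm k s'"
  shows "norm (state_error s s') \<le> 2 * sqrt (real CARD('c)) * sbar P xm k"
proof -
  let ?n = "sqrt (real CARD('c))" and ?c = "cbar P xm k" and ?h = "hbar P xm k"
  have twice: "\<bar>a - b\<bar> \<le> 2 * B" if "\<bar>a\<bar> \<le> B" "\<bar>b\<bar> \<le> B" for a b B :: real
    using that by arith
  have "norm (fst s - fst s') \<le> ?n * (2 * ?c)"
  proof (rule norm_le_sqrt_CARD)
    fix j
    have "\<bar>fst s $ j\<bar> \<le> ?c" "\<bar>fst s' $ j\<bar> \<le> ?c"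
      using s s' by (auto simp: in_S_def)
    then show "\<bar>(fst s - fst s') $ j\<bar> \<le> 2 * ?c"
      unfolding vector_minus_component by (rule twice)
  qed
  moreover have "norm (snd s - snd s') \<le> ?n * (2 * ?h)"
  proof (rule norm_le_sqrt_CARD)
    fix j
    have "\<bar>snd s $ j\<bar> \<le> ?h" "\<bar>snd s' $ j\<bar> \<le> ?h"
      using s s' by (auto simp: in_S_def)
    then show "\<bar>(snd s - snd s') $ j\<bar> \<le> 2 * ?h"
      unfolding vector_minus_component by (rule twice)
  qed
  ultimately have "norm (state_error s s') \<le> sqrt ((?n * (2 * ?c))\<^sup>2 + (?n * (2 * ?h))\<^sup>2)"
    unfolding state_error_def norm_vec_2 by (intro real_sqrt_le_mono add_mono power_mono) auto
  also have "(?n * (2 * ?c))\<^sup>2 + (?n * (2 * ?h))\<^sup>2 = (2 * ?n)\<^sup>2 * (?c\<^sup>2 + ?h\<^sup>2)"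
    by (simp add: power_mult_distrib algebra_simps)
  also have "sqrt \<dots> = 2 * ?n * sqrt (?c\<^sup>2 + ?h\<^sup>2)"
    by (simp add: real_sqrt_mult)
  also have "sqrt (?c\<^sup>2 + ?h\<^sup>2) = sbar P xm k"
    by (simp add: sbar_def hbar_def norm_vec_2)
  finally show ?thesis .
qed


section \<open>Powers of a \<open>2 \<times> 2\<close> matrix in Schur form\<close>

lemma quadratic_form_nonneg:
  fixes a g X p q :: real
  assumes "0 \<le> a" and "0 \<le> g" and "X\<^sup>2 \<le> a * g"
  shows "0 \<le> a * p\<^sup>2 - 2 * X * p * q + g * q\<^sup>2"
proof (cases "a = 0")
  case True
  then have "X = 0" using assms by simp
  then show ?thesis using True assms by simp
next
  case False
  then have a: "0 < a" using assms by simp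
  have "a * (a * p\<^sup>2 - 2 * X * p * q + g * q\<^sup>2) = (a * p - X * q)\<^sup>2 + (a * g - X\<^sup>2) * q\<^sup>2"
    by (simp add: power2_eq_square algebra_simps)
  also have "\<dots> \<ge> 0" using assms by simp
  finally show ?thesis using a by (simp add: zero_le_mult_iff)
qed

lemma geometric_sum_sq_estimate:
  fixes r :: real
  assumes r0: "0 \<le> r" and r1: "r \<le> 1" and "j \<le> t"
  shows "(\<Sum>i<j. r^i)\<^sup>2 * (1 + (r^t)\<^sup>2) \<le> (\<Sum>i<t. r^i)\<^sup>2 * (1 - (r^j)\<^sup>2 + 2 * (r^t)\<^sup>2)"
proof (cases "r = 1")
  case True
  then show ?thesis using \<open>j \<le> t\<close> by (simp add: power_mono)
next
  case False
  let ?u = "r^j" and ?v = "r^t"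
  have uv: "0 \<le> ?v" "?v \<le> ?u" "?u \<le> 1"
    using r0 r1 power_decreasing[OF \<open>j \<le> t\<close> r0 r1] by (auto simp: power_le_one)
  have "(1 - ?v)\<^sup>2 * (1 - ?u\<^sup>2 + 2 * ?v\<^sup>2) - (1 - ?u)\<^sup>2 * (1 + ?v\<^sup>2)
      = 2 * (?u - ?v) * ((1 - ?u) * (1 - ?v) + ?v\<^sup>2 * (2 - ?u - ?v))"
    by (simp add: power2_eq_square algebra_simps)
  also have "\<dots> \<ge> 0"
    using uv by (intro mult_nonneg_nonneg add_nonneg_nonneg) auto
  finally have "(1 - ?u)\<^sup>2 * (1 + ?v\<^sup>2) / (1 - r)\<^sup>2 \<le> (1 - ?v)\<^sup>2 * (1 - ?u\<^sup>2 + 2 * ?v\<^sup>2) / (1 - r)\<^sup>2"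
    by (simp add: divide_right_mono)
  then show ?thesis
    using False by (simp add: sum_gp_strict power_divide)
qed

text \<open>This is where \<open>\<mu>(t)\<close> comes from: for the triangular Schur factor \<open>T\<close>, the squared
  moduli of the coordinates of \<open>T\<^sup>j w / \<lambda>\<^sub>1\<^sup>j\<close> sum to at most the left-hand side, where
  \<open>r = |\<lambda>\<^sub>2|/\<lambda>\<^sub>1\<close>, \<open>c = |\<nu>|/\<lambda>\<^sub>1\<close>, \<open>p = |w\<^sub>1|\<close> and \<open>q = |w\<^sub>2|\<close>.\<close>

lemma triangular_power_estimate:
  fixes r c p q :: real
  assumes r0: "0 \<le> r" and r1: "r \<le> 1" and c0: "0 \<le> c" and jt: "j \<le> t"
  shows "(p + c * (\<Sum>i<j. r^i) * q)\<^sup>2 + (r^j * q)\<^sup>2 \<le> (1 + r^(2*t) + c\<^sup>2 * (\<Sum>i<t. r^i)\<^sup>2) * (p\<^sup>2 + q\<^sup>2)"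
proof -
  define Gj Gt u v where "Gj = (\<Sum>i<j. r^i)" and "Gt = (\<Sum>i<t. r^i)" and "u = r^j" and "v = r^t"
  define X Y where "X = c * Gj" and "Y = c * Gt"
  define a g where "a = Y\<^sup>2 + v\<^sup>2" and "g = 1 - u\<^sup>2 + Y\<^sup>2 + v\<^sup>2 - X\<^sup>2"
  have "0 \<le> Gj" "Gj \<le> Gt"
    unfolding Gj_def Gt_def using r0 jt by (auto intro: sum_nonneg sum_mono2)
  then have XY: "X\<^sup>2 \<le> Y\<^sup>2"
    unfolding X_def Y_def using c0 by (simp add: power_mono mult_left_mono)
  have u2: "u\<^sup>2 \<le> 1"
    unfolding u_def using r0 r1 by (simp add: power_le_one flip: power_mult)
  have "a * g - X\<^sup>2 = Y\<^sup>2 * (Y\<^sup>2 - X\<^sup>2) + c\<^sup>2 * (Gt\<^sup>2 * (1 - u\<^sup>2 + 2 * v\<^sup>2) - Gj\<^sup>2 * (1 + v\<^sup>2))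
      + v\<^sup>2 * (1 - u\<^sup>2 + v\<^sup>2)"
    unfolding a_def g_def X_def Y_def by (simp add: power2_eq_square algebra_simps)
  also have "\<dots> \<ge> 0"
    using XY u2 geometric_sum_sq_estimate[OF r0 r1 jt]
    by (intro add_nonneg_nonneg mult_nonneg_nonneg) (auto simp: Gj_def Gt_def u_def v_def)
  finally have "X\<^sup>2 \<le> a * g" by simp
  moreover have "0 \<le> g"
    unfolding g_def using XY u2 zero_le_power2[of v] by linarith
  ultimately have "0 \<le> a * p\<^sup>2 - 2 * X * p * q + g * q\<^sup>2"
    by (intro quadratic_form_nonneg) (simp_all add: a_def)
  moreover have "(1 + r^(2*t) + c\<^sup>2 * Gt\<^sup>2) * (p\<^sup>2 + q\<^sup>2) - ((p + X * q)\<^sup>2 + (u * q)\<^sup>2)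
      = a * p\<^sup>2 - 2 * X * p * q + g * q\<^sup>2"
    unfolding a_def g_def X_def Y_def v_def by (simp add: power2_eq_square power_mult algebra_simps)
  ultimately show ?thesis
    unfolding X_def u_def Gj_def Gt_def by (simp add: mult.assoc)
qed

definition cvec :: "real^'n \<Rightarrow> complex^'n" where
  "cvec v = (\<chi> i. complex_of_real (v $ i))"

definition cinner :: "complex^'n::finite \<Rightarrow> complex^'n \<Rightarrow> complex" where
  "cinner x y = (\<Sum>i\<in>UNIV. x $ i * cnj (y $ i))"

lemma norm_cvec: "norm (cvec v) = norm (v::real^'n::finite)"
  unfolding norm_vec_def cvec_def by simp

lemma cvec_iterate: "cvec (((*v) A ^^ j) v) = ((*v) (cmat A) ^^ j) (cvec v)"
  for A :: "real^'n::finite^'n"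
proof (induction j)
  case (Suc j)
  then show ?case
    by (simp add: cmat_def cvec_def matrix_vector_mult_def vec_eq_iff)
qed simp

lemma cinner_self: "cinner x x = complex_of_real ((norm (x::complex^'n::finite))\<^sup>2)"
proof -
  have "(norm x)\<^sup>2 = (\<Sum>i\<in>UNIV. (norm (x $ i))\<^sup>2)"
    unfolding norm_vec_def L2_set_def by (simp add: sum_nonneg)
  then have "complex_of_real ((norm x)\<^sup>2) = (\<Sum>i\<in>UNIV. complex_of_real ((norm (x $ i))\<^sup>2))"
    by (simp only: of_real_sum)
  also have "\<dots> = cinner x x"
    unfolding cinner_def by (rule sum.cong[OF refl]) (rule complex_norm_square)
  finally show ?thesis ..
qed

lemma cinner_adjoint: "cinner (M *v x) y = cinner x (cadj M *v y)"
  for M :: "complex^'n::finite^'m::finite"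
proof -
  have "cinner (M *v x) y = (\<Sum>i\<in>UNIV. \<Sum>j\<in>UNIV. M $ i $ j * x $ j * cnj (y $ i))"
    by (simp add: cinner_def matrix_vector_mult_def sum_distrib_right)
  also have "\<dots> = (\<Sum>j\<in>UNIV. \<Sum>i\<in>UNIV. M $ i $ j * x $ j * cnj (y $ i))"
    by (rule sum.swap)
  also have "\<dots> = cinner x (cadj M *v y)"
    by (simp add: cinner_def matrix_vector_mult_def cadj_def sum_distrib_left mult_ac)
  finally show ?thesis .
qed

lemma norm_unitary_mult:
  assumes "cadj U ** U = mat 1"
  shows "norm (U *v x) = norm (x::complex^'n::finite)"
proof -
  have "cinner (U *v x) (U *v x) = cinner x x"
    by (simp add: cinner_adjoint matrix_vector_mul_assoc assms)
  then have "(norm (U *v x))\<^sup>2 = (norm x)\<^sup>2"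
    unfolding cinner_self of_real_eq_iff .
  then show ?thesis by (simp add: power2_eq_iff_nonneg)
qed

lemma cadj_cadj: "cadj (cadj U) = U"
  by (simp add: cadj_def vec_eq_iff)

lemma iterate_unitary_similar:
  assumes "cadj U ** U = mat 1" and "U ** cadj U = mat 1"
  shows "((*v) (U ** T ** cadj U) ^^ j) v = U *v (((*v) T ^^ j) (cadj U *v v))"
proof (induction j)
  case 0
  then show ?case by (simp add: matrix_vector_mul_assoc assms)
next
  case (Suc j)
  then have "((*v) (U ** T ** cadj U) ^^ Suc j) v
      = U *v (T *v ((cadj U ** U) *v ((*v) T ^^ j) (cadj U *v v)))"
    by (simp add: matrix_vector_mul_assoc matrix_mul_assoc)
  then show ?case by (simp add: assms)
qed

definition triangular2 :: "real \<Rightarrow> complex \<Rightarrow> real \<Rightarrow> complex^2^2" where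
  "triangular2 l1 nu l2 = (\<chi> i j. if i = 1 \<and> j = 1 then complex_of_real l1
                                else if i = 1 \<and> j = 2 then nu
                                else if i = 2 \<and> j = 2 then complex_of_real l2 else 0)"

lemma schur2_D:
  assumes "schur2 A U l1 nu l2"
  shows "cadj U ** U = mat 1" and "U ** cadj U = mat 1"
    and "cmat A = U ** triangular2 l1 nu l2 ** cadj U" and "l2 \<le> l1"
  using assms unfolding schur2_def triangular2_def by auto

lemma triangular2_mult_vec:
  "(triangular2 l1 nu l2 *v w) $ 1 = complex_of_real l1 * w $ 1 + nu * w $ 2"
  "(triangular2 l1 nu l2 *v w) $ 2 = complex_of_real l2 * w $ 2"
  by (simp_all add: triangular2_def matrix_vector_mult_def sum_2)

fun offdiag_sum :: "real \<Rightarrow> real \<Rightarrow> nat \<Rightarrow> real" where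
  "offdiag_sum l1 l2 0 = 0"
| "offdiag_sum l1 l2 (Suc j) = l1 * offdiag_sum l1 l2 j + l2 ^ j"

lemma triangular2_iterate:
  "((*v) (triangular2 l1 nu l2) ^^ j) w $ 1
     = complex_of_real (l1 ^ j) * w $ 1 + nu * complex_of_real (offdiag_sum l1 l2 j) * w $ 2"
  "((*v) (triangular2 l1 nu l2) ^^ j) w $ 2 = complex_of_real (l2 ^ j) * w $ 2"
proof (induction j)
  case (Suc j)
  { case 1 show ?case using Suc by (simp add: triangular2_mult_vec algebra_simps) }
  { case 2 show ?case using Suc by (simp add: triangular2_mult_vec) }
qed simp_all

lemma abs_offdiag_sum_le:
  assumes "0 < l1"
  shows "\<bar>offdiag_sum l1 l2 j\<bar> * l1 \<le> l1 ^ j * (\<Sum>i<j. (\<bar>l2\<bar> / l1) ^ i)"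
proof (induction j)
  case (Suc j)
  have "\<bar>offdiag_sum l1 l2 (Suc j)\<bar> \<le> l1 * \<bar>offdiag_sum l1 l2 j\<bar> + \<bar>l2\<bar> ^ j"
    using assms abs_triangle_ineq[of "l1 * offdiag_sum l1 l2 j" "l2 ^ j"]
    by (simp add: abs_mult power_abs)
  then have "\<bar>offdiag_sum l1 l2 (Suc j)\<bar> * l1 \<le> (l1 * \<bar>offdiag_sum l1 l2 j\<bar> + \<bar>l2\<bar> ^ j) * l1"
    by (rule mult_right_mono) (use assms in simp)
  also have "\<dots> = l1 * (\<bar>offdiag_sum l1 l2 j\<bar> * l1) + l1 ^ Suc j * (\<bar>l2\<bar> / l1) ^ j"
    using assms by (simp add: power_divide field_simps)
  also have "\<dots> \<le> l1 * (l1 ^ j * (\<Sum>i<j. (\<bar>l2\<bar> / l1) ^ i)) + l1 ^ Suc j * (\<bar>l2\<bar> / l1) ^ j"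
    using Suc.IH assms by simp
  also have "\<dots> = l1 ^ Suc j * (\<Sum>i<Suc j. (\<bar>l2\<bar> / l1) ^ i)"
    by (simp add: algebra_simps)
  finally show ?case .
qed simp

lemma mu_fn_nonneg: "0 \<le> mu_fn l1 nu l2 t"
  unfolding mu_fn_def Let_def by simp

lemma mu_fn_eq_geometric_sum:
  assumes "0 < l1"
  shows "mu_fn l1 nu l2 t
    = sqrt (1 + (\<bar>l2\<bar> / l1) ^ (2 * t) + (cmod nu / l1)\<^sup>2 * (\<Sum>i<t. (\<bar>l2\<bar> / l1) ^ i)\<^sup>2)"
proof -
  define r where "r = \<bar>l2\<bar> / l1"
  have a: "\<bar>l2\<bar> / \<bar>l1\<bar> = r"
    unfolding r_def using assms by simp
  have b: "(if r = 1 then real t else (1 - r ^ t) / (1 - r)) = (\<Sum>i<t. r ^ i)"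
    by (simp add: sum_gp_strict)
  have c: "(cmod nu)\<^sup>2 / \<bar>l1\<bar>\<^sup>2 = (cmod nu / l1)\<^sup>2"
    using assms by (simp add: power_divide)
  show ?thesis
    unfolding mu_fn_def Let_def a b c r_def[symmetric] by simp
qed

lemma norm_triangular2_iterate_le:
  assumes l1: "0 < l1" and l2: "\<bar>l2\<bar> \<le> l1" and "j \<le> t"
  shows "norm (((*v) (triangular2 l1 nu l2) ^^ j) w) \<le> mu_fn l1 nu l2 t * l1 ^ j * norm w"
proof -
  define r c p q where "r = \<bar>l2\<bar> / l1" and "c = cmod nu / l1"
    and "p = cmod (w $ 1)" and "q = cmod (w $ 2)"
  let ?z = "((*v) (triangular2 l1 nu l2) ^^ j) w"
  have r: "0 \<le> r" "r \<le> 1" and c: "0 \<le> c" and q: "0 \<le> q"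
    unfolding r_def c_def q_def using l1 l2 by auto
  have "cmod (?z $ 1) \<le> cmod (complex_of_real (l1 ^ j) * w $ 1)
      + cmod (nu * complex_of_real (offdiag_sum l1 l2 j) * w $ 2)"
    unfolding triangular2_iterate by (rule norm_triangle_ineq)
  also have "\<dots> = l1 ^ j * p + cmod nu * (\<bar>offdiag_sum l1 l2 j\<bar> * q)"
    unfolding p_def q_def using l1 by (simp add: norm_mult norm_power)
  also have "cmod nu * (\<bar>offdiag_sum l1 l2 j\<bar> * q) = c * (\<bar>offdiag_sum l1 l2 j\<bar> * l1) * q"
    unfolding c_def using l1 by simp
  also have "\<dots> \<le> c * (l1 ^ j * (\<Sum>i<j. r ^ i)) * q"
    unfolding r_def using abs_offdiag_sum_le[OF l1] c q by (intro mult_right_mono mult_left_mono)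
  finally have z1: "cmod (?z $ 1) \<le> l1 ^ j * (p + c * (\<Sum>i<j. r ^ i) * q)"
    by (simp add: algebra_simps)
  have z2: "cmod (?z $ 2) = l1 ^ j * (r ^ j * q)"
    unfolding triangular2_iterate q_def r_def using l1 by (simp add: norm_mult norm_power power_divide)
  have "(cmod (?z $ 1))\<^sup>2 + (cmod (?z $ 2))\<^sup>2
      \<le> (l1 ^ j)\<^sup>2 * ((p + c * (\<Sum>i<j. r ^ i) * q)\<^sup>2 + (r ^ j * q)\<^sup>2)"
    using power_mono[OF z1 norm_ge_zero, of 2] unfolding z2 power_mult_distrib by (simp add: distrib_left)
  also have "\<dots> \<le> (l1 ^ j)\<^sup>2 * ((1 + r ^ (2 * t) + c\<^sup>2 * (\<Sum>i<t. r ^ i)\<^sup>2) * (p\<^sup>2 + q\<^sup>2))"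
    by (intro mult_left_mono triangular_power_estimate r c \<open>j \<le> t\<close>) simp
  finally have "sqrt ((cmod (?z $ 1))\<^sup>2 + (cmod (?z $ 2))\<^sup>2)
      \<le> sqrt ((l1 ^ j)\<^sup>2 * ((1 + r ^ (2 * t) + c\<^sup>2 * (\<Sum>i<t. r ^ i)\<^sup>2) * (p\<^sup>2 + q\<^sup>2)))"
    by (rule real_sqrt_le_mono)
  also have "\<dots> = l1 ^ j * sqrt (1 + r ^ (2 * t) + c\<^sup>2 * (\<Sum>i<t. r ^ i)\<^sup>2) * sqrt (p\<^sup>2 + q\<^sup>2)"
    using l1 by (simp add: real_sqrt_mult)
  finally show ?thesis
    unfolding norm_vec_2[of ?z] norm_vec_2[of w] mu_fn_eq_geometric_sum[OF l1] p_def q_def r_def c_def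
    by (simp add: mult_ac)
qed

lemma schur2_iterate_norm_le:
  fixes A :: "real^2^2"
  assumes s: "schur2 A U l1 nu l2" and "0 < l1" and "\<bar>l2\<bar> \<le> l1" and "j \<le> t"
  shows "norm (((*v) A ^^ j) v) \<le> mu_fn l1 nu l2 t * l1 ^ j * norm v"
proof -
  note D = schur2_D[OF s]
  have "norm (((*v) A ^^ j) v) = norm (U *v ((*v) (triangular2 l1 nu l2) ^^ j) (cadj U *v cvec v))"
    unfolding norm_cvec[symmetric] cvec_iterate D(3) iterate_unitary_similar[OF D(1,2)] ..
  also have "\<dots> = norm (((*v) (triangular2 l1 nu l2) ^^ j) (cadj U *v cvec v))"
    by (rule norm_unitary_mult[OF D(1)])
  also have "\<dots> \<le> mu_fn l1 nu l2 t * l1 ^ j * norm (cadj U *v cvec v)"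
    using assms by (intro norm_triangular2_iterate_le)
  also have "norm (cadj U *v cvec v) = norm v"
    using norm_unitary_mult[of "cadj U" "cvec v"] D(2) by (simp add: cadj_cadj norm_cvec)
  finally show ?thesis .
qed

lemma schur2_lambda_bounds:
  fixes A :: "real^2^2"
  assumes s: "schur2 A U l1 nu l2" and "0 < A $ 1 $ 1 + A $ 2 $ 2"
  shows "0 < l1" and "\<bar>l2\<bar> \<le> l1"
proof -
  note D = schur2_D[OF s]
  have "trace (cmat A) = trace (cadj U ** (U ** triangular2 l1 nu l2))"
    unfolding D(3) by (rule trace_mul_sym)
  also have "\<dots> = trace (triangular2 l1 nu l2)"
    by (simp add: matrix_mul_assoc D(1))
  finally have "l1 + l2 = A $ 1 $ 1 + A $ 2 $ 2"
    by (simp add: trace_def sum_2 cmat_def triangular2_def flip: of_real_add)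
  then show "0 < l1" "\<bar>l2\<bar> \<le> l1"
    using D(4) assms(2) by auto
qed

lemma schur2_eigenvalue_cases:
  fixes A :: "real^2^2"
  assumes s: "schur2 A U l1 nu l2" and "v \<noteq> 0" and ev: "cmat A *v v = z *s v"
  shows "z = complex_of_real l1 \<or> z = complex_of_real l2"
proof -
  note D = schur2_D[OF s]
  define w where "w = cadj U *v v"
  have "w \<noteq> 0"
    using \<open>v \<noteq> 0\<close> norm_unitary_mult[of "cadj U" v] D(2) by (auto simp: w_def cadj_cadj)
  moreover have "cadj U *v (cmat A *v v) = triangular2 l1 nu l2 *v w"
    unfolding w_def D(3) by (simp add: matrix_vector_mul_assoc matrix_mul_assoc D(1))
  then have "triangular2 l1 nu l2 *v w = z *s w"
    by (simp add: ev w_def vector_scalar_commute)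
  then have "complex_of_real l1 * w $ 1 + nu * w $ 2 = z * w $ 1"
    and "complex_of_real l2 * w $ 2 = z * w $ 2"
    by (metis triangular2_mult_vec vector_smult_component)+
  ultimately show ?thesis
    by (cases "w $ 2 = 0") (auto simp: vec_eq_iff forall_2)
qed

lemma schur2_lambda1_eigenvalue:
  fixes A :: "real^2^2"
  assumes s: "schur2 A U l1 nu l2"
  shows "U *v axis 1 1 \<noteq> 0" and "cmat A *v (U *v axis 1 1) = complex_of_real l1 *s (U *v axis 1 1)"
proof -
  note D = schur2_D[OF s]
  show "U *v axis 1 1 \<noteq> 0"
    using norm_unitary_mult[OF D(1), of "axis 1 1"] by auto
  have "triangular2 l1 nu l2 *v axis 1 1 = complex_of_real l1 *s axis 1 1"
    by (simp add: vec_eq_iff forall_2 triangular2_mult_vec axis_def)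
  moreover have "cadj U *v (U *v axis 1 1) = axis 1 1"
    by (simp add: matrix_vector_mul_assoc D(1))
  ultimately show "cmat A *v (U *v axis 1 1) = complex_of_real l1 *s (U *v axis 1 1)"
    unfolding D(3) matrix_vector_mul_assoc[symmetric] by (simp add: vector_scalar_commute)
qed

lemma schur2_lambda_le_spec_rad:
  fixes A :: "real^2^2"
  assumes s: "schur2 A U l1 nu l2"
  shows "\<bar>l1\<bar> \<le> spec_rad (cmat A)"
proof -
  define S where "S = {cmod z | z. \<exists>v. v \<noteq> 0 \<and> cmat A *v v = z *s v}"
  have "S \<subseteq> {\<bar>l1\<bar>, \<bar>l2\<bar>}"
    unfolding S_def using schur2_eigenvalue_cases[OF s] by fastforce
  then have "bdd_above S"
    by (rule bdd_above_mono[OF bdd_above_finite, rotated]) simp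
  moreover have "\<bar>l1\<bar> \<in> S"
    unfolding S_def using schur2_lambda1_eigenvalue[OF s] by force
  ultimately show ?thesis
    unfolding spec_rad_def S_def[symmetric] by (rule cSup_upper[rotated])
qed


section \<open>Nonnegative linear recursions\<close>

lemma matrix_vector_mult_mono_nonneg:
  fixes A :: "real^'n::finite^'m::finite"
  assumes "\<And>i j. 0 \<le> A $ i $ j" and "x \<le> y"
  shows "A *v x \<le> A *v y"
  using assms unfolding less_eq_vec_def
  by (auto simp: matrix_vector_mult_def intro!: sum_mono mult_left_mono)

lemma le_iterate_sum:
  fixes A :: "real^'n::finite^'n" and a :: "real^'n" and E :: "nat \<Rightarrow> real^'n"
  assumes A: "\<And>i j. 0 \<le> A $ i $ j"
    and step: "\<And>\<tau>. E (Suc \<tau>) \<le> A *v E \<tau> + d \<tau> *\<^sub>R a"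
  shows "E \<tau> \<le> ((*v) A ^^ \<tau>) (E 0) + (\<Sum>\<sigma><\<tau>. d \<sigma> *\<^sub>R ((*v) A ^^ (\<tau> - 1 - \<sigma>)) a)"
proof (induction \<tau>)
  case (Suc \<tau>)
  have shift: "A *v ((*v) A ^^ (\<tau> - 1 - \<sigma>)) a = ((*v) A ^^ (Suc \<tau> - 1 - \<sigma>)) a" if "\<sigma> < \<tau>" for \<sigma>
  proof -
    have "Suc \<tau> - 1 - \<sigma> = Suc (\<tau> - 1 - \<sigma>)"
      using that by simp
    then show ?thesis by simp
  qed
  have "E (Suc \<tau>) \<le> A *v E \<tau> + d \<tau> *\<^sub>R a"
    by (rule step)
  also have "\<dots> \<le> A *v (((*v) A ^^ \<tau>) (E 0) + (\<Sum>\<sigma><\<tau>. d \<sigma> *\<^sub>R ((*v) A ^^ (\<tau> - 1 - \<sigma>)) a)) + d \<tau> *\<^sub>R a"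
    using matrix_vector_mult_mono_nonneg[OF A Suc.IH] by (rule add_right_mono)
  also have "\<dots> = ((*v) A ^^ Suc \<tau>) (E 0) + (\<Sum>\<sigma><\<tau>. d \<sigma> *\<^sub>R (A *v ((*v) A ^^ (\<tau> - 1 - \<sigma>)) a)) + d \<tau> *\<^sub>R a"
    by (simp add: matrix_vector_right_distrib linear_sum[OF matrix_vector_mul_linear] o_def
        matrix_vector_mult_scaleR)
  also have "(\<Sum>\<sigma><\<tau>. d \<sigma> *\<^sub>R (A *v ((*v) A ^^ (\<tau> - 1 - \<sigma>)) a))
      = (\<Sum>\<sigma><\<tau>. d \<sigma> *\<^sub>R ((*v) A ^^ (Suc \<tau> - 1 - \<sigma>)) a)"
    by (intro sum.cong refl arg_cong2[where f = scaleR] shift) auto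
  finally show ?case
    by (simp add: add.assoc)
qed simp

lemma norm_le_iterate_sum:
  fixes A :: "real^'n::finite^'n" and a :: "real^'n" and E :: "nat \<Rightarrow> real^'n"
  assumes A: "\<And>i j. 0 \<le> A $ i $ j" and E: "\<And>\<tau>. 0 \<le> E \<tau>" and d: "\<And>\<sigma>. 0 \<le> d \<sigma>"
    and step: "\<And>\<tau>. E (Suc \<tau>) \<le> A *v E \<tau> + d \<tau> *\<^sub>R a"
  shows "norm (E \<tau>) \<le> norm (((*v) A ^^ \<tau>) (E 0)) + (\<Sum>\<sigma><\<tau>. d \<sigma> * norm (((*v) A ^^ (\<tau> - 1 - \<sigma>)) a))"
proof -
  let ?R = "((*v) A ^^ \<tau>) (E 0) + (\<Sum>\<sigma><\<tau>. d \<sigma> *\<^sub>R ((*v) A ^^ (\<tau> - 1 - \<sigma>)) a)"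
  have "norm (E \<tau>) \<le> norm ?R"
    using E[of \<tau>] le_iterate_sum[of A E d a \<tau>, OF A step]
    by (intro norm_le_componentwise_cart) (force simp: less_eq_vec_def intro: order_trans[OF _ abs_ge_self])
  also have "\<dots> \<le> norm (((*v) A ^^ \<tau>) (E 0)) + (\<Sum>\<sigma><\<tau>. norm (d \<sigma> *\<^sub>R ((*v) A ^^ (\<tau> - 1 - \<sigma>)) a))"
    by (rule norm_triangle_le) (intro add_left_mono norm_sum)
  finally show ?thesis
    using d by simp
qed

lemma schur2_recursion_norm_le:
  fixes A :: "real^2^2" and a :: "real^2" and E :: "nat \<Rightarrow> real^2"
  assumes s: "schur2 A U l1 nu l2" and l1: "0 < l1" "\<bar>l2\<bar> \<le> l1" "l1 \<le> \<rho>"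
    and A: "\<And>i j. 0 \<le> A $ i $ j" and E: "\<And>\<tau>. 0 \<le> E \<tau>" and d: "\<And>\<sigma>. 0 \<le> d \<sigma>"
    and step: "\<And>\<tau>. E (Suc \<tau>) \<le> A *v E \<tau> + d \<tau> *\<^sub>R a"
    and "\<tau> \<le> t"
  shows "norm (E \<tau>) \<le> mu_fn l1 nu l2 t * \<rho> ^ \<tau> * norm (E 0)
    + norm a * mu_fn l1 nu l2 t * (\<Sum>\<sigma><\<tau>. \<rho> ^ (\<tau> - 1 - \<sigma>) * d \<sigma>)"
proof -
  have power: "norm (((*v) A ^^ j) v) \<le> mu_fn l1 nu l2 t * \<rho> ^ j * norm v" if "j \<le> t" for j v
  proof -
    have "norm (((*v) A ^^ j) v) \<le> mu_fn l1 nu l2 t * l1 ^ j * norm v"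
      using s l1(1,2) that by (rule schur2_iterate_norm_le)
    also have "\<dots> \<le> mu_fn l1 nu l2 t * \<rho> ^ j * norm v"
      using l1 by (intro mult_right_mono mult_left_mono power_mono) (auto simp: mu_fn_nonneg)
    finally show ?thesis .
  qed
  have "norm (E \<tau>) \<le> norm (((*v) A ^^ \<tau>) (E 0)) + (\<Sum>\<sigma><\<tau>. d \<sigma> * norm (((*v) A ^^ (\<tau> - 1 - \<sigma>)) a))"
    using A E d step by (rule norm_le_iterate_sum)
  also have "\<dots> \<le> mu_fn l1 nu l2 t * \<rho> ^ \<tau> * norm (E 0)
      + (\<Sum>\<sigma><\<tau>. d \<sigma> * (mu_fn l1 nu l2 t * \<rho> ^ (\<tau> - 1 - \<sigma>) * norm a))"
    using \<open>\<tau> \<le> t\<close> d by (intro add_mono power sum_mono mult_left_mono) auto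
  also have "(\<Sum>\<sigma><\<tau>. d \<sigma> * (mu_fn l1 nu l2 t * \<rho> ^ (\<tau> - 1 - \<sigma>) * norm a))
      = norm a * mu_fn l1 nu l2 t * (\<Sum>\<sigma><\<tau>. \<rho> ^ (\<tau> - 1 - \<sigma>) * d \<sigma>)"
    by (simp add: sum_distrib_left mult_ac)
  finally show ?thesis .
qed


section \<open>Accumulating the errors over the layers\<close>

text \<open>Summand \<open>m\<close> of \<open>\<beta>\<close> for the network truncated at layer \<open>l\<close>, with horizon \<open>t\<close> in \<open>\<mu>\<close>
  and time \<open>\<tau>\<close>; the binomial coefficient is the factor \<open>(\<tau>+l-m)!/(\<tau>!(l-m)!)\<close> of the paper.\<close>

definition beta_term :: "(nat \<Rightarrow> real) \<Rightarrow> (nat \<Rightarrow> nat \<Rightarrow> real) \<Rightarrow> (nat \<Rightarrow> real) \<Rightarrow> (nat \<Rightarrow> real)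
    \<Rightarrow> nat \<Rightarrow> nat \<Rightarrow> nat \<Rightarrow> nat \<Rightarrow> real" where
  "beta_term rho mu ax s t l \<tau> m = (\<Prod>i\<in>{m..l}. mu i t) * real ((\<tau> + (l - m)) choose (l - m))
     * (MAX i\<in>{m..l}. rho i ^ \<tau>) * (\<Prod>i\<in>{m+1..l}. ax i) * s m"

lemma sum_choose_le:
  "(\<Sum>\<sigma><\<tau>. real ((Suc \<sigma> + n) choose n)) \<le> real ((\<tau> + Suc n) choose Suc n)"
proof -
  have "(\<Sum>\<sigma><\<tau>. real ((Suc \<sigma> + n) choose n))
      \<le> real ((0 + n) choose n) + (\<Sum>\<sigma><\<tau>. real ((Suc \<sigma> + n) choose n))"
    by simp
  also have "\<dots> = (\<Sum>j<Suc \<tau>. real ((j + n) choose n))"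
    by (rule sum.lessThan_Suc_shift[symmetric])
  also have "\<dots> = real (\<Sum>j\<le>\<tau>. (n + j) choose n)"
    by (simp add: lessThan_Suc_atMost add.commute)
  also have "\<dots> = real ((n + \<tau> + 1) choose (n + 1))"
    by (simp only: choose_rising_sum(1))
  finally show ?thesis
    by (simp add: add.commute)
qed

lemma Max_power_eq:
  fixes rho :: "nat \<Rightarrow> real"
  assumes "\<And>i. i \<in> {m..l} \<Longrightarrow> 0 \<le> rho i" and "m \<le> l"
  shows "(MAX i\<in>{m..l}. rho i ^ n) = (MAX i\<in>{m..l}. rho i) ^ n"
proof -
  have "Max (rho ` {m..l}) \<in> rho ` {m..l}"
    using \<open>m \<le> l\<close> by (intro Max_in) auto
  then obtain i0 where i0: "i0 \<in> {m..l}" "rho i0 = (MAX i\<in>{m..l}. rho i)"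
    by auto
  show ?thesis
  proof (rule antisym)
    show "(MAX i\<in>{m..l}. rho i ^ n) \<le> (MAX i\<in>{m..l}. rho i) ^ n"
      using assms i0 by (auto simp: Max_le_iff intro!: power_mono)
    show "(MAX i\<in>{m..l}. rho i) ^ n \<le> (MAX i\<in>{m..l}. rho i ^ n)"
      using i0 by (metis Max_ge finite_atLeastAtMost finite_imageI imageI)
  qed
qed

text \<open>One more layer convolves the bound with \<open>\<rho>\<^sup>\<tau>\<close>; the powers of the spectral radii are
  dominated by their maximum and the hockey-stick identity raises the binomial coefficient.\<close>

lemma beta_term_convolution:
  assumes rho: "\<And>i. i \<in> {m..Suc l} \<Longrightarrow> 0 \<le> rho i" and mu: "\<And>i t. 0 \<le> mu i t"
    and ax: "\<And>i. 0 \<le> ax i" and s: "0 \<le> s m" and "m \<le> l"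
  shows "ax (Suc l) * mu (Suc l) t * (\<Sum>\<sigma><\<tau>. rho (Suc l) ^ (\<tau> - 1 - \<sigma>) * beta_term rho mu ax s t l (Suc \<sigma>) m)
    \<le> beta_term rho mu ax s t (Suc l) \<tau> m"
proof -
  define n where "n = l - m"
  define R where "R = (MAX i\<in>{m..Suc l}. rho i)"
  define K where "K = ax (Suc l) * mu (Suc l) t * (\<Prod>i\<in>{m..l}. mu i t) * (\<Prod>i\<in>{m+1..l}. ax i) * s m"
  have R: "rho i \<le> R" if "i \<in> {m..Suc l}" for i
    unfolding R_def using that by (intro Max_ge) auto
  have R0: "0 \<le> R"
    using rho[of m] R[of m] \<open>m \<le> l\<close> by auto
  have K: "0 \<le> K"
    unfolding K_def using ax mu s by (intro mult_nonneg_nonneg prod_nonneg) auto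
  have pow: "rho (Suc l) ^ (\<tau> - 1 - \<sigma>) * (MAX i\<in>{m..l}. rho i ^ Suc \<sigma>) \<le> R ^ \<tau>" if "\<sigma> < \<tau>" for \<sigma>
  proof -
    have "rho i ^ Suc \<sigma> \<le> R ^ Suc \<sigma>" if "i \<in> {m..l}" for i
      using that R rho by (intro power_mono) auto
    then have "(MAX i\<in>{m..l}. rho i ^ Suc \<sigma>) \<le> R ^ Suc \<sigma>"
      using \<open>m \<le> l\<close> by (subst Max_le_iff) auto
    moreover have "0 \<le> (MAX i\<in>{m..l}. rho i ^ Suc \<sigma>)"
      using \<open>m \<le> l\<close> rho[of m] by (auto simp: Max_ge_iff intro!: bexI[of _ m])
    ultimately have "rho (Suc l) ^ (\<tau> - 1 - \<sigma>) * (MAX i\<in>{m..l}. rho i ^ Suc \<sigma>) \<le> R ^ (\<tau> - 1 - \<sigma>) * R ^ Suc \<sigma>"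
      using \<open>m \<le> l\<close> R R0 rho by (intro mult_mono power_mono) auto
    also have "\<dots> = R ^ (\<tau> - 1 - \<sigma> + Suc \<sigma>)"
      by (simp only: power_add)
    also have "\<tau> - 1 - \<sigma> + Suc \<sigma> = \<tau>"
      using that by simp
    finally show ?thesis .
  qed
  have "ax (Suc l) * mu (Suc l) t * (\<Sum>\<sigma><\<tau>. rho (Suc l) ^ (\<tau> - 1 - \<sigma>) * beta_term rho mu ax s t l (Suc \<sigma>) m)
      = K * (\<Sum>\<sigma><\<tau>. real ((Suc \<sigma> + n) choose n) * (rho (Suc l) ^ (\<tau> - 1 - \<sigma>) * (MAX i\<in>{m..l}. rho i ^ Suc \<sigma>)))"
    unfolding K_def beta_term_def n_def by (simp add: sum_distrib_left mult_ac)
  also have "\<dots> \<le> K * ((\<Sum>\<sigma><\<tau>. real ((Suc \<sigma> + n) choose n)) * R ^ \<tau>)"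
    unfolding sum_distrib_right using K pow by (intro mult_left_mono sum_mono) auto
  also have "\<dots> \<le> K * (real ((\<tau> + Suc n) choose Suc n) * R ^ \<tau>)"
    using K R0 by (intro mult_left_mono mult_right_mono sum_choose_le) auto
  also have "\<dots> = beta_term rho mu ax s t (Suc l) \<tau> m"
  proof -
    have "(MAX i\<in>{m..Suc l}. rho i ^ \<tau>) = R ^ \<tau>"
      unfolding R_def using rho \<open>m \<le> l\<close> by (intro Max_power_eq) auto
    then show ?thesis
      using \<open>m \<le> l\<close> by (simp add: beta_term_def K_def n_def Suc_diff_le prod.cl_ivl_Suc mult_ac)
  qed
  finally show ?thesis .
qed

lemma le_sum_beta_term:
  fixes F :: "nat \<Rightarrow> nat \<Rightarrow> real"
  assumes rho: "\<And>l. 1 \<le> l \<Longrightarrow> l \<le> L \<Longrightarrow> 0 \<le> rho l" and mu: "\<And>l t. 0 \<le> mu l t"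
    and ax: "\<And>l. 0 \<le> ax l" and s: "\<And>l. 0 \<le> s l"
    and first: "\<And>\<tau>. \<tau> \<le> t \<Longrightarrow> F 1 \<tau> \<le> mu 1 t * rho 1 ^ \<tau> * s 1"
    and higher: "\<And>l \<tau>. 2 \<le> l \<Longrightarrow> l \<le> L \<Longrightarrow> \<tau> \<le> t \<Longrightarrow>
      F l \<tau> \<le> mu l t * rho l ^ \<tau> * s l + ax l * mu l t * (\<Sum>\<sigma><\<tau>. rho l ^ (\<tau> - 1 - \<sigma>) * F (l - 1) (Suc \<sigma>))"
    and "1 \<le> l" and "l \<le> L" and "\<tau> \<le> t"
  shows "F l \<tau> \<le> (\<Sum>m\<in>{1..l}. beta_term rho mu ax s t l \<tau> m)"
  using \<open>1 \<le> l\<close> \<open>l \<le> L\<close> \<open>\<tau> \<le> t\<close>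
proof (induction l arbitrary: \<tau> rule: nat_induct_at_least)
  case base
  then show ?case
    using first by (simp add: beta_term_def)
next
  case (Suc l)
  let ?B = "\<lambda>m \<sigma>. beta_term rho mu ax s t l \<sigma> m"
  have "F (Suc l) \<tau> \<le> mu (Suc l) t * rho (Suc l) ^ \<tau> * s (Suc l)
      + ax (Suc l) * mu (Suc l) t * (\<Sum>\<sigma><\<tau>. rho (Suc l) ^ (\<tau> - 1 - \<sigma>) * F l (Suc \<sigma>))"
    using higher[of "Suc l" \<tau>] Suc by simp
  also have "\<dots> \<le> mu (Suc l) t * rho (Suc l) ^ \<tau> * s (Suc l)
      + ax (Suc l) * mu (Suc l) t * (\<Sum>\<sigma><\<tau>. rho (Suc l) ^ (\<tau> - 1 - \<sigma>) * (\<Sum>m\<in>{1..l}. ?B m (Suc \<sigma>)))"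
    using Suc rho[of "Suc l"] ax mu
    by (intro add_left_mono mult_left_mono sum_mono mult_nonneg_nonneg) auto
  also have "\<dots> = mu (Suc l) t * rho (Suc l) ^ \<tau> * s (Suc l)
      + (\<Sum>m\<in>{1..l}. ax (Suc l) * mu (Suc l) t * (\<Sum>\<sigma><\<tau>. rho (Suc l) ^ (\<tau> - 1 - \<sigma>) * ?B m (Suc \<sigma>)))"
    by (simp add: sum_distrib_left sum_distrib_right mult_ac) (rule sum.swap)
  also have "\<dots> \<le> mu (Suc l) t * rho (Suc l) ^ \<tau> * s (Suc l)
      + (\<Sum>m\<in>{1..l}. beta_term rho mu ax s t (Suc l) \<tau> m)"
    using Suc rho by (intro add_left_mono sum_mono beta_term_convolution mu ax s) auto
  also have "\<dots> = (\<Sum>m\<in>{1..Suc l}. beta_term rho mu ax s t (Suc l) \<tau> m)"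
    using Suc by (simp add: sum.cl_ivl_Suc beta_term_def)
  finally show ?case .
qed

lemma sum_beta_term_eq_beta_tilde:
  assumes "1 \<le> L"
  shows "(\<Sum>m\<in>{1..L}. beta_term rho mu ax s t L t m) = beta_tilde L rho mu ax s t"
proof -
  have "real ((t + (L - m)) choose (L - m)) = fact (t + L - m) / (fact t * fact (L - m))" if "m < L" for m
  proof -
    have "real ((t + (L - m)) choose (L - m)) = fact (t + (L - m)) / (fact (L - m) * fact (t + (L - m) - (L - m)))"
      by (rule binomial_fact) simp
    then show ?thesis
      using that by (simp add: mult.commute)
  qed
  moreover have "{1..L} = insert L {1..<L}"
    using assms by auto
  ultimately show ?thesis
    unfolding beta_tilde_def by (simp add: beta_term_def)
qed


section \<open>Trajectories of the network\<close>

lemma traj_Suc_1: "traj P1 Ps x s0 (Suc t) 1 = cell P1 (x t) (traj P1 Ps x s0 t 1)"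
  by (simp add: One_nat_def)

lemma traj_Suc_Suc_Suc:
  "traj P1 Ps x s0 (Suc t) (Suc (Suc m))
     = cell (Ps (Suc (Suc m))) (snd (traj P1 Ps x s0 (Suc t) (Suc m))) (traj P1 Ps x s0 t (Suc (Suc m)))"
  by simp

lemma abs_snd_traj_le_1:
  assumes "1 \<le> l"
  shows "\<bar>snd (traj P1 Ps x s0 (Suc t) l) $ j\<bar> \<le> 1"
proof -
  obtain m where "l = Suc m"
    using assms by (cases l) auto
  then show ?thesis
    by (cases m) (simp_all add: abs_snd_cell_le_1)
qed

lemma init_set_in_S:
  assumes "s0 \<in> init_set P1 Ps xmax k L"
  shows "1 \<le> L \<Longrightarrow> in_S P1 xmax k (s0 1)"
    and "2 \<le> l \<Longrightarrow> l \<le> L \<Longrightarrow> in_S (Ps l) 1 k (s0 l)"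
proof -
  have *: "infnorm (fst (s0 l)) \<le> cbarL P1 Ps xmax k l
      \<and> infnorm (snd (s0 l)) \<le> tanh (cbarL P1 Ps xmax k l) * sig_oL P1 Ps xmax k l"
    if "1 \<le> l" "l \<le> L" for l
    using assms that unfolding init_set_def by auto
  show "in_S P1 xmax k (s0 1)" if "1 \<le> L"
    using *[of 1] that by (simp add: in_S_def infnorm_le_iff_cart cbarL_def sig_oL_def hbar_def)
  show "in_S (Ps l) 1 k (s0 l)" if "2 \<le> l" "l \<le> L"
    using *[of l] that by (simp add: in_S_def infnorm_le_iff_cart cbarL_def sig_oL_def hbar_def)
qed

lemma traj_first_in_S:
  assumes "0 \<le> xmax" and "\<And>t j. \<bar>x t $ j\<bar> \<le> xmax"
    and "s0 \<in> init_set P1 Ps xmax k L" and "1 \<le> L"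
  shows "in_S P1 xmax k (traj P1 Ps x s0 t 1)"
proof (induction t)
  case 0
  then show ?case using init_set_in_S(1)[OF assms(3,4)] by simp
next
  case (Suc t)
  then show ?case
    unfolding traj_Suc_1 using assms(1,2) by (rule cell_in_S[rotated 2])
qed

lemma traj_higher_in_S:
  assumes "s0 \<in> init_set P1 Ps xmax k L" and "2 \<le> l" and "l \<le> L"
  shows "in_S (Ps l) 1 k (traj P1 Ps x s0 t l)"
proof (induction t)
  case 0
  then show ?case using init_set_in_S(2)[OF assms] by simp
next
  case (Suc t)
  define m where "m = l - 2"
  have l: "l = Suc (Suc m)"
    unfolding m_def using \<open>2 \<le> l\<close> by arith
  show ?case
    unfolding l traj_Suc_Suc_Suc using Suc abs_snd_traj_le_1[of "Suc m"]
    by (intro cell_in_S) (simp_all add: l)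
qed

lemma A_sL_nonneg: "0 \<le> A_sL P1 Ps xmax k l $ i $ j"
  by (simp add: A_sL_def A_s_nonneg)

lemma A_sL_trace_pos: "0 < A_sL P1 Ps xmax k l $ 1 $ 1 + A_sL P1 Ps xmax k l $ 2 $ 2"
  by (simp add: A_sL_def A_s_trace_pos)

locale lstm_recovery =
  fixes P1 :: "('x::finite, 'c::finite) lstm_layer" and Ps :: "nat \<Rightarrow> ('c, 'c) lstm_layer"
    and xmax :: real and k L t0 :: nat and x xh :: "nat \<Rightarrow> real^'x"
    and s0 :: "nat \<Rightarrow> (real^'c) \<times> (real^'c)"
  assumes L_pos: "1 \<le> L" and xmax_nonneg: "0 \<le> xmax"
    and x_bounded: "\<And>t j. \<bar>x t $ j\<bar> \<le> xmax" and xh_bounded: "\<And>t j. \<bar>xh t $ j\<bar> \<le> xmax"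
    and inputs_agree: "\<And>t. t0 \<le> t \<Longrightarrow> x t = xh t"
    and s0_init: "s0 \<in> init_set P1 Ps xmax k L"
begin

definition err :: "nat \<Rightarrow> nat \<Rightarrow> real^2" where
  "err l \<tau> = state_error (traj P1 Ps x s0 (t0 + \<tau>) l) (traj P1 Ps xh s0 (t0 + \<tau>) l)"

lemma err_nonneg: "0 \<le> err l \<tau>"
  unfolding err_def by (rule state_error_nonneg)

lemma norm_err_le:
  assumes "1 \<le> l" and "l \<le> L"
  shows "norm (err l \<tau>) \<le> 2 * sqrt (real CARD('c)) * sbarL P1 Ps xmax k l"
proof (cases "l = 1")
  case True
  then show ?thesis
    unfolding err_def sbarL_def
    using traj_first_in_S[OF xmax_nonneg x_bounded s0_init L_pos]
      traj_first_in_S[OF xmax_nonneg xh_bounded s0_init L_pos]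
    by (simp add: norm_state_error_le_sbar)
next
  case False
  then show ?thesis
    unfolding err_def sbarL_def
    using traj_higher_in_S[OF s0_init _ \<open>l \<le> L\<close>] assms
    by (simp add: norm_state_error_le_sbar)
qed

lemma err_first_Suc: "err 1 (Suc \<tau>) \<le> A_sL P1 Ps xmax k 1 *v err 1 \<tau>"
proof -
  have "x (t0 + \<tau>) = xh (t0 + \<tau>)"
    by (simp add: inputs_agree)
  then show ?thesis
    unfolding err_def add_Suc_right traj_Suc_1
    using state_error_cell_le[OF xmax_nonneg x_bounded[of "t0 + \<tau>"] xh_bounded[of "t0 + \<tau>"]
        traj_first_in_S[OF xmax_nonneg x_bounded s0_init L_pos]
        traj_first_in_S[OF xmax_nonneg xh_bounded s0_init L_pos]]
    by (simp add: A_sL_def)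
qed

lemma err_higher_Suc:
  assumes "2 \<le> l" and "l \<le> L"
  shows "err l (Suc \<tau>) \<le> A_sL P1 Ps xmax k l *v err l \<tau> + (err (l - 1) (Suc \<tau>) $ 2) *\<^sub>R a_xL P1 Ps xmax k l"
proof -
  define m where "m = l - 2"
  have l: "l = Suc (Suc m)"
    unfolding m_def using \<open>2 \<le> l\<close> by arith
  have "err l (Suc \<tau>) \<le> A_s (Ps l) 1 k *v err l \<tau>
      + norm (snd (traj P1 Ps x s0 (Suc (t0 + \<tau>)) (Suc m)) - snd (traj P1 Ps xh s0 (Suc (t0 + \<tau>)) (Suc m)))
        *\<^sub>R a_x (Ps l) 1 k"
    unfolding err_def add_Suc_right l traj_Suc_Suc_Suc
    using traj_higher_in_S[OF s0_init assms] abs_snd_traj_le_1[of "Suc m"]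
    by (intro state_error_cell_le) (simp_all add: l)
  then show ?thesis
    by (simp add: A_sL_def a_xL_def err_def state_error_def l)
qed

lemma norm_err_le_driven:
  assumes schur: "schur2 (A_sL P1 Ps xmax k l) U' l1 \<nu> l2" and l: "1 \<le> l" "l \<le> L"
    and "\<sigma> \<le> t" and d: "\<And>\<sigma>. 0 \<le> d \<sigma>"
    and step: "\<And>\<sigma>. err l (Suc \<sigma>) \<le> A_sL P1 Ps xmax k l *v err l \<sigma> + d \<sigma> *\<^sub>R a_xL P1 Ps xmax k l"
  shows "norm (err l \<sigma>) \<le> mu_fn l1 \<nu> l2 t * spec_rad (cmat (A_sL P1 Ps xmax k l)) ^ \<sigma>
      * (2 * sqrt (real CARD('c)) * sbarL P1 Ps xmax k l)
    + norm (a_xL P1 Ps xmax k l) * mu_fn l1 \<nu> l2 t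
      * (\<Sum>\<sigma>'<\<sigma>. spec_rad (cmat (A_sL P1 Ps xmax k l)) ^ (\<sigma> - 1 - \<sigma>') * d \<sigma>')"
proof -
  let ?\<rho> = "spec_rad (cmat (A_sL P1 Ps xmax k l))"
  have lam: "0 < l1" "\<bar>l2\<bar> \<le> l1" "l1 \<le> ?\<rho>"
    using schur2_lambda_bounds[OF schur A_sL_trace_pos] schur2_lambda_le_spec_rad[OF schur] by auto
  have "norm (err l \<sigma>) \<le> mu_fn l1 \<nu> l2 t * ?\<rho> ^ \<sigma> * norm (err l 0)
      + norm (a_xL P1 Ps xmax k l) * mu_fn l1 \<nu> l2 t * (\<Sum>\<sigma>'<\<sigma>. ?\<rho> ^ (\<sigma> - 1 - \<sigma>') * d \<sigma>')"
    using schur lam A_sL_nonneg err_nonneg d step \<open>\<sigma> \<le> t\<close> by (rule schur2_recursion_norm_le)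
  also have "\<dots> \<le> mu_fn l1 \<nu> l2 t * ?\<rho> ^ \<sigma> * (2 * sqrt (real CARD('c)) * sbarL P1 Ps xmax k l)
      + norm (a_xL P1 Ps xmax k l) * mu_fn l1 \<nu> l2 t * (\<Sum>\<sigma>'<\<sigma>. ?\<rho> ^ (\<sigma> - 1 - \<sigma>') * d \<sigma>')"
    using norm_err_le[OF l] lam
    by (intro add_right_mono mult_left_mono mult_nonneg_nonneg mu_fn_nonneg) auto
  finally show ?thesis .
qed

lemma norm_err_le_beta_tilde:
  assumes schur: "\<And>l. 1 \<le> l \<Longrightarrow> l \<le> L \<Longrightarrow> schur2 (A_sL P1 Ps xmax k l) (U l) (lam1 l) (nu l) (lam2 l)"
  shows "norm (err L \<tau>) \<le> beta_tilde L (\<lambda>l. spec_rad (cmat (A_sL P1 Ps xmax k l)))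
      (\<lambda>l t. mu_fn (lam1 l) (nu l) (lam2 l) t) (\<lambda>l. norm (a_xL P1 Ps xmax k l))
      (\<lambda>l. 2 * sqrt (real CARD('c)) * sbarL P1 Ps xmax k l) \<tau>"
proof -
  define rho where "rho l = spec_rad (cmat (A_sL P1 Ps xmax k l))" for l
  define mu where "mu l t = mu_fn (lam1 l) (nu l) (lam2 l) t" for l t
  define ax where "ax l = norm (a_xL P1 Ps xmax k l)" for l
  define sv where "sv l = 2 * sqrt (real CARD('c)) * sbarL P1 Ps xmax k l" for l
  have driven: "norm (err l \<sigma>) \<le> mu l \<tau> * rho l ^ \<sigma> * sv l
      + ax l * mu l \<tau> * (\<Sum>\<sigma>'<\<sigma>. rho l ^ (\<sigma> - 1 - \<sigma>') * d \<sigma>')"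
    if "1 \<le> l" "l \<le> L" "\<sigma> \<le> \<tau>" "\<And>\<sigma>. 0 \<le> d \<sigma>"
      "\<And>\<sigma>. err l (Suc \<sigma>) \<le> A_sL P1 Ps xmax k l *v err l \<sigma> + d \<sigma> *\<^sub>R a_xL P1 Ps xmax k l"
    for l \<sigma> d
    unfolding rho_def mu_def ax_def sv_def using schur[OF that(1,2)] that by (rule norm_err_le_driven)
  have rho: "0 \<le> rho l" if "1 \<le> l" "l \<le> L" for l
    using schur2_lambda_bounds[OF schur[OF that] A_sL_trace_pos] schur2_lambda_le_spec_rad[OF schur[OF that]]
    unfolding rho_def by fastforce
  have first: "norm (err 1 \<sigma>) \<le> mu 1 \<tau> * rho 1 ^ \<sigma> * sv 1" if "\<sigma> \<le> \<tau>" for \<sigma>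
    using driven[of 1 \<sigma> "\<lambda>_. 0"] err_first_Suc L_pos that by simp
  have higher: "norm (err l \<sigma>) \<le> mu l \<tau> * rho l ^ \<sigma> * sv l
      + ax l * mu l \<tau> * (\<Sum>\<sigma>'<\<sigma>. rho l ^ (\<sigma> - 1 - \<sigma>') * norm (err (l - 1) (Suc \<sigma>')))"
    if "2 \<le> l" "l \<le> L" "\<sigma> \<le> \<tau>" for l \<sigma>
  proof -
    have "norm (err l \<sigma>) \<le> mu l \<tau> * rho l ^ \<sigma> * sv l
        + ax l * mu l \<tau> * (\<Sum>\<sigma>'<\<sigma>. rho l ^ (\<sigma> - 1 - \<sigma>') * (err (l - 1) (Suc \<sigma>') $ 2))"
      by (rule driven) (use that err_higher_Suc in \<open>simp_all add: err_def state_error_def\<close>)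
    also have "\<dots> \<le> mu l \<tau> * rho l ^ \<sigma> * sv l
        + ax l * mu l \<tau> * (\<Sum>\<sigma>'<\<sigma>. rho l ^ (\<sigma> - 1 - \<sigma>') * norm (err (l - 1) (Suc \<sigma>')))"
      using rho[of l] that
      by (intro add_left_mono mult_left_mono sum_mono vec_nth_le_norm)
         (simp_all add: ax_def mu_def mu_fn_nonneg)
    finally show ?thesis .
  qed
  have mu: "0 \<le> mu l t" and ax: "0 \<le> ax l" and sv: "0 \<le> sv l" for l t
    by (simp_all add: mu_def mu_fn_nonneg ax_def sv_def sbarL_def sbar_def)
  have "norm (err L \<tau>) \<le> (\<Sum>m\<in>{1..L}. beta_term rho mu ax sv \<tau> L \<tau> m)"
    by (rule le_sum_beta_term[where F = "\<lambda>l \<sigma>. norm (err l \<sigma>)" and rho = rho and mu = mu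
          and ax = ax and s = sv and t = \<tau>, OF rho mu ax sv first higher L_pos order_refl order_refl])
  then show ?thesis
    unfolding sum_beta_term_eq_beta_tilde[OF L_pos] rho_def mu_def ax_def sv_def .
qed

lemma output_error_le:
  assumes "\<And>l. 1 \<le> l \<Longrightarrow> l \<le> L \<Longrightarrow> schur2 (A_sL P1 Ps xmax k l) (U l) (lam1 l) (nu l) (lam2 l)"
  shows "norm (lstm_out P1 Ps Uy b_y L x s0 (t0 + \<tau>) - lstm_out P1 Ps Uy b_y L xh s0 (t0 + \<tau>))
    \<le> opnorm Uy * beta_tilde L (\<lambda>l. spec_rad (cmat (A_sL P1 Ps xmax k l)))
      (\<lambda>l t. mu_fn (lam1 l) (nu l) (lam2 l) t) (\<lambda>l. norm (a_xL P1 Ps xmax k l))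
      (\<lambda>l. 2 * sqrt (real CARD('c)) * sbarL P1 Ps xmax k l) \<tau>"
proof -
  have "norm (lstm_out P1 Ps Uy b_y L x s0 (t0 + \<tau>) - lstm_out P1 Ps Uy b_y L xh s0 (t0 + \<tau>))
      \<le> opnorm Uy * norm (snd (traj P1 Ps x s0 (t0 + \<tau>) L) - snd (traj P1 Ps xh s0 (t0 + \<tau>) L))"
    by (simp add: lstm_out_def norm_mult_vec_le_opnorm flip: matrix_vector_mult_diff_distrib)
  also have "\<dots> \<le> opnorm Uy * norm (err L \<tau>)"
    using vec_nth_le_norm[of "err L \<tau>" 2] opnorm_nonneg[of Uy]
    by (intro mult_left_mono) (simp_all add: err_def state_error_def)
  also have "\<dots> \<le> opnorm Uy * beta_tilde L (\<lambda>l. spec_rad (cmat (A_sL P1 Ps xmax k l)))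
      (\<lambda>l t. mu_fn (lam1 l) (nu l) (lam2 l) t) (\<lambda>l. norm (a_xL P1 Ps xmax k l))
      (\<lambda>l. 2 * sqrt (real CARD('c)) * sbarL P1 Ps xmax k l) \<tau>"
    using norm_err_le_beta_tilde[OF assms] opnorm_nonneg[of Uy] by (rule mult_left_mono)
  finally show ?thesis .
qed

end


section \<open>Recovery time\<close>

lemma recovery_time_le:
  assumes "\<And>\<tau>. T \<le> \<tau> \<Longrightarrow>
    norm (lstm_out P1 Ps Uy b_y L x s0 (t0 + \<tau>) - lstm_out P1 Ps Uy b_y L xh s0 (t0 + \<tau>)) \<le> e"
  shows "recovery_time P1 Ps Uy b_y L x xh s0 t0 e \<le> enat T"
proof -
  define R where "R = {t. t0 \<le> t \<and> (\<forall>t'\<ge>t. norm (lstm_out P1 Ps Uy b_y L x s0 t' - lstm_out P1 Ps Uy b_y L xh s0 t') \<le> e)}"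
  have "norm (lstm_out P1 Ps Uy b_y L x s0 t' - lstm_out P1 Ps Uy b_y L xh s0 t') \<le> e"
    if "t0 + T \<le> t'" for t'
    using assms[of "t' - t0"] that by simp
  then have "t0 + T \<in> R"
    unfolding R_def by simp
  then have "R \<noteq> {}" and "(LEAST t. t \<in> R) - t0 \<le> T"
    using Least_le[of "\<lambda>t. t \<in> R" "t0 + T"] by auto
  then show ?thesis
    unfolding recovery_time_def Let_def R_def[symmetric] by simp
qed

lemma SUP_le_least_enat:
  assumes "\<And>s t. s \<in> S \<Longrightarrow> t \<in> R \<Longrightarrow> f s \<le> enat t"
  shows "(SUP s\<in>S. f s) \<le> least_enat R"
proof (cases "R = {}")
  case False
  then have "(LEAST t. t \<in> R) \<in> R"
    by (auto intro: LeastI)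
  then show ?thesis
    unfolding least_enat_def using False assms by (auto intro: SUP_least)
qed (simp add: least_enat_def)

theorem theorem5p3:
  fixes P1 :: "('x::finite, 'c::finite) lstm_layer"
    and Ps :: "nat \<Rightarrow> ('c, 'c) lstm_layer"
    and Uy :: "real^'c^'y::finite" and b_y :: "real^'y"
    and L k t0 :: nat and xmax e :: real
    and x xh :: "nat \<Rightarrow> real^'x"
    and U :: "nat \<Rightarrow> complex^2^2" and lam1 lam2 :: "nat \<Rightarrow> real" and nu :: "nat \<Rightarrow> complex"
  assumes "L \<ge> 1" and "xmax > 0"
    and "\<forall>l\<in>{1..L}. spec_rad (cmat (A_sL P1 Ps xmax k l)) < 1"
    and "\<forall>l\<in>{1..L}. schur2 (A_sL P1 Ps xmax k l) (U l) (lam1 l) (nu l) (lam2 l)"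
    and "\<forall>t j. \<bar>x t $ j\<bar> \<le> xmax" and "\<forall>t j. \<bar>xh t $ j\<bar> \<le> xmax"
    and "e > 0"
    and "\<forall>t\<ge>t0. x t = xh t"
  shows "(SUP s0\<in>init_set P1 Ps xmax k L. recovery_time P1 Ps Uy b_y L x xh s0 t0 e)
         \<le> least_enat {t. \<forall>t'\<ge>t.
              beta_tilde L (\<lambda>l. spec_rad (cmat (A_sL P1 Ps xmax k l)))
                (\<lambda>l t. mu_fn (lam1 l) (nu l) (lam2 l) t)
                (\<lambda>l. norm (a_xL P1 Ps xmax k l))
                (\<lambda>l. 2 * sqrt (real CARD('c)) * sbarL P1 Ps xmax k l) t'
              \<le> e / opnorm Uy}"
proof (rule SUP_le_least_enat)
  let ?beta = "beta_tilde L (\<lambda>l. spec_rad (cmat (A_sL P1 Ps xmax k l)))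
    (\<lambda>l t. mu_fn (lam1 l) (nu l) (lam2 l) t) (\<lambda>l. norm (a_xL P1 Ps xmax k l))
    (\<lambda>l. 2 * sqrt (real CARD('c)) * sbarL P1 Ps xmax k l)"
  fix s0 T
  assume "s0 \<in> init_set P1 Ps xmax k L" and T: "T \<in> {t. \<forall>t'\<ge>t. ?beta t' \<le> e / opnorm Uy}"
  interpret lstm_recovery P1 Ps xmax k L t0 x xh s0
    using assms \<open>s0 \<in> init_set P1 Ps xmax k L\<close> by unfold_locales auto
  have schur: "schur2 (A_sL P1 Ps xmax k l) (U l) (lam1 l) (nu l) (lam2 l)" if "1 \<le> l" "l \<le> L" for l
    using assms(4) that by simp
  show "recovery_time P1 Ps Uy b_y L x xh s0 t0 e \<le> enat T"
  proof (rule recovery_time_le)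
    fix \<tau> assume "T \<le> \<tau>"
    have "norm (lstm_out P1 Ps Uy b_y L x s0 (t0 + \<tau>) - lstm_out P1 Ps Uy b_y L xh s0 (t0 + \<tau>))
        \<le> opnorm Uy * ?beta \<tau>"
      by (rule output_error_le[OF schur])
    also have "\<dots> \<le> opnorm Uy * (e / opnorm Uy)"
      using T \<open>T \<le> \<tau>\<close> opnorm_nonneg[of Uy] by (intro mult_left_mono) auto
    also have "\<dots> \<le> e"
      using \<open>e > 0\<close> opnorm_nonneg[of Uy] by (cases "opnorm Uy = 0") auto
    finally show "norm (lstm_out P1 Ps Uy b_y L x s0 (t0 + \<tau>) - lstm_out P1 Ps Uy b_y L xh s0 (t0 + \<tau>)) \<le> e" .
  qed
qed

end
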